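(* Let $X$ be a smooth projective toric scheme over $\mathrm{Spec}(\mathbb{Z})$ of relative dimension $d$. Let $D$ be an equivariant Cartier divisor on $X$ and let $\overline{D}=(D,\|\cdot\|_{\overline{D}})$ be the line bundle $\mathcal{O}(D)$ endowed with a continuous hermitian metric $\|\cdot\|_{\overline{D}}$ that is invariant under the action of the compact torus $S_Q$ of $X(\mathbb{C})$. Then $$\widehat{\mathrm{vol}}(\overline{D})=(d+1)!\int_{\Theta_{\overline{D}}}\check{g}_{\overline{D}}(x)\,dx,$$ where $\Theta_{\overline{D}}=\{x\in\Delta_D : \check{g}_{\overline{D}}(x)\ge 0\}$.
   Context: Toric setting. $Q$ is a free $\mathbb{Z}$-module of rank $d$, $P$ its dual, $Q_{\mathbb{R}}=Q\otimes_{\mathbb{Z}}\mathbb{R}$, $P_{\mathbb{R}}=P\otimes_{\mathbb{Z}}\mathbb{R}$. $X$ is the toric scheme over $\mathrm{Spec}(\mathbb{Z})$ attached to a fan $\Sigma$ in $Q_{\mathbb{R}}$ (obtained by gluing the $\mathrm{Spec}\,\mathbb{Z}[P\cap\sigma^*]$, $\sigma\in\Sigma$, where $\sigma^*$ is the dual cone). It contains the torus $\mathbb{T}=\mathrm{Spec}\,\mathbb{Z}[P]$ as an open subset, and $\mathbb{T}$ acts on $X$. For $m\in P$, $\chi^m$ is the corresponding character. The compact torus is $S_Q=\{t\in\mathbb{T}(\mathbb{C}) : |t|=1\}$. An equivariant Cartier divisor $D$ is a $\mathbb{T}$-invariant one; it corresponds to a continuous function $\psi_D:Q_{\mathbb{R}}\to\mathbb{R}$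 with $\psi_D(u)=\langle m_\sigma,u\rangle$ on each $\sigma\in\Sigma$ ($m_\sigma\in P$), $D$ having local equation $\chi^{-m_\sigma}$ on $\mathrm{Spec}\,\mathbb{Z}[P\cap\sigma^*]$. Put $\Delta_D=\{x\in P_{\mathbb{R}} : \langle x,u\rangle\ge\psi_D(u)\ \forall u\in Q_{\mathbb{R}}\}$. Then $H^0(X,\mathcal{O}(lD))=\bigoplus_{m\in l\Delta_D\cap P}\mathbb{Z}\chi^m$. Let $s_D$ be the rational section of $\mathcal{O}(D)$ associated to $D$ (corresponding to the rational function $1$). For $u\in Q_{\mathbb{R}}$, let $\exp(-u)\in\mathbb{T}(\mathbb{C})=\mathrm{Hom}(P,\mathbb{C}^* )$ be the point $m\mapsto e^{-\langle m,u\rangle}$. Put $g_{\overline{D}}(u)=\log\|s_D(\exp(-u))\|_{\overline{D}}$ for $u\in Q_{\mathbb{R}}$, and let $\check{g}_{\overline{D}}(x)=\inf_{u\in Q_{\mathbb{R}}}(\langle x,u\rangle-g_{\overline{D}}(u))$ for $x\in P_{\mathbb{R}}$ be its Legendre–Fenchel transform; it is finite exactly on $\Delta_D$ and concave there. $l\overline{D}$ denotes $\mathcal{O}(lD)$ with the $l$-th tensor power metric; $\|s\|_{\sup}=\sup_{x\in X(\mathbb{C})}\|s\|(x)$; $\widehat{H}^0(X,l\overline{D})=\{s\in H^0(X,\mathcal{O}(lD)) : \|s\|_{\sup}\le1\}$; and $$\widehat{\mathrm{vol}}(\overline{D})=\limsup_{l\to\infty}\frac{\log\#\widehat{H}^0(X,l\overline{D})}{l^{d+1}/(d+1)!}.$$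 $dx$ is the Lebesgue measure on $P_{\mathbb{R}}$ normalized so that the lattice $P$ has covolume $1$ (standard Lebesgue measure after identifying $P$ with $\mathbb{Z}^d$). *)

theory Defs
  imports
    "HOL-Analysis.Analysis"
    "HOL-Algebra.Generated_Rings"
    "HOL-Algebra.QuotRing"
    "HOL-Algebra.Algebraic_Closure_Type"
    "HOL-Library.Poly_Mapping"
    "HOL-Computational_Algebra.Fraction_Field"
begin

section \<open>The lattices\<close>

text \<open>
  A basis of \<open>Q\<close> is fixed, so that \<open>Q\<close> and \<open>P\<close> are both \<open>int ^ 'n\<close>, their real extensions are
  \<open>real ^ 'n\<close>, the pairing is the standard inner product, the rank \<open>d \<ge> 1\<close> is \<open>CARD('n)\<close> and \<open>dx\<close> is
  \<open>lborel\<close>.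
\<close>

definition real_vec :: "int ^ 'n \<Rightarrow> real ^ 'n" where
  "real_vec m = (\<chi> i. real_of_int (m $ i))"

abbreviation pairing :: "int ^ 'n \<Rightarrow> real ^ 'n \<Rightarrow> real" where
  "pairing m u \<equiv> real_vec m \<bullet> u"

section \<open>The ring of Laurent polynomials and its field of fractions\<close>

text \<open>
  \<open>int ^ 'n \<Rightarrow>\<^sub>0 int\<close> is the group ring of \<open>P\<close>. The library only knows it to be an integral domain
  when the exponents are linearly ordered, and \<open>int ^ 'n\<close> carries the componentwise order.
  The type \<open>'n laurent\<close> is a copy of this ring on which the integral domain property is established.
\<close>

typedef (overloaded) 'n laurent = "UNIV :: (int ^ 'n::finite \<Rightarrow>\<^sub>0 int) set"
  morphisms poly_of Laurent ..

setup_lifting type_definition_laurent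

instantiation laurent :: (finite) comm_ring_1
begin
lift_definition zero_laurent :: "'a laurent" is 0 .
lift_definition one_laurent :: "'a laurent" is 1 .
lift_definition plus_laurent :: "'a laurent \<Rightarrow> 'a laurent \<Rightarrow> 'a laurent" is "(+)" .
lift_definition minus_laurent :: "'a laurent \<Rightarrow> 'a laurent \<Rightarrow> 'a laurent" is "(-)" .
lift_definition uminus_laurent :: "'a laurent \<Rightarrow> 'a laurent" is "uminus" .
lift_definition times_laurent :: "'a laurent \<Rightarrow> 'a laurent \<Rightarrow> 'a laurent" is "(*)" .
instance
  by intro_classes (transfer, simp add: algebra_simps)+
end

lemma lookup_times_unique_sum:
  fixes f g :: "'a::monoid_add \<Rightarrow>\<^sub>0 'b::semiring_0"
  assumes "\<And>k l. k \<in> Poly_Mapping.keys f \<Longrightarrow> l \<in> Poly_Mapping.keys g \<Longrightarrow> k + l = a + b \<Longrightarrow> k = a \<and> l = b"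
  shows "Poly_Mapping.lookup (f * g) (a + b) = Poly_Mapping.lookup f a * Poly_Mapping.lookup g b"
proof -
  let ?f = "Poly_Mapping.lookup f" and ?g = "Poly_Mapping.lookup g"
  have "Poly_Mapping.lookup (f * g) (a + b) = prod_fun ?f ?g (a + b)"
    by (simp add: times_poly_mapping.rep_eq)
  also have "\<dots> = (\<Sum>(k, l). ?f k * ?g l when a + b = k + l)"
    by (rule prod_fun_unfold_prod) simp_all
  also have "(\<lambda>(k, l). ?f k * ?g l when a + b = k + l) = (\<lambda>p. ?f a * ?g b when p = (a, b))"
  proof
    fix p :: "'a \<times> 'a"
    obtain k l where p: "p = (k, l)" by (cases p)
    show "(\<lambda>(k, l). ?f k * ?g l when a + b = k + l) p = (?f a * ?g b when p = (a, b))"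
    proof (cases "k \<in> Poly_Mapping.keys f \<and> l \<in> Poly_Mapping.keys g")
      case True
      then show ?thesis using assms[of k l] p by (auto simp: when_def)
    next
      case False
      then have "?f k = 0 \<or> ?g l = 0" by (auto simp: in_keys_iff)
      then show ?thesis using p by (auto simp: when_def)
    qed
  qed
  finally show ?thesis by simp
qed

lemma exists_additive_embedding:
  "\<exists>r :: int ^ 'n::finite \<Rightarrow> (nat \<Rightarrow>\<^sub>0 int). inj r \<and> (\<forall>x y. r (x + y) = r x + r y)"
proof -
  obtain e :: "'n \<Rightarrow> nat" where e: "inj e"
    using finite_imp_inj_to_nat_seg[of "UNIV :: 'n set"] by auto
  define r :: "int ^ 'n \<Rightarrow> (nat \<Rightarrow>\<^sub>0 int)" where
    "r m = (\<Sum>i\<in>UNIV. Poly_Mapping.single (e i) (m $ i))" for m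
  have "Poly_Mapping.lookup (r m) (e j) = m $ j" for m j
    using e by (simp add: r_def lookup_sum lookup_single when_def inj_eq)
  then have "inj r"
    by (intro injI) (metis vec_eq_iff)
  moreover have "r (x + y) = r x + r y" for x y
    by (simp add: r_def single_add sum.distrib)
  ultimately show ?thesis by blast
qed

lemma laurent_no_zero_divisors:
  fixes f g :: "int ^ 'n::finite \<Rightarrow>\<^sub>0 int"
  assumes "f \<noteq> 0" "g \<noteq> 0"
  shows "f * g \<noteq> 0"
proof -
  obtain r :: "int ^ 'n \<Rightarrow> (nat \<Rightarrow>\<^sub>0 int)" where r: "inj r" "\<And>x y. r (x + y) = r x + r y"
    using exists_additive_embedding by blast
  have max: "\<exists>a\<in>Poly_Mapping.keys h. \<forall>k\<in>Poly_Mapping.keys h. r k \<le> r a"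
    if "h \<noteq> 0" for h :: "int ^ 'n \<Rightarrow>\<^sub>0 int"
  proof -
    have ne: "r ` Poly_Mapping.keys h \<noteq> {}" using that by simp
    have fin: "finite (r ` Poly_Mapping.keys h)" by simp
    from Max_in[OF fin ne] obtain a
      where "a \<in> Poly_Mapping.keys h" "r a = Max (r ` Poly_Mapping.keys h)"
      by auto
    then show ?thesis using Max_ge[OF fin] by (metis imageI)
  qed
  obtain a where a: "a \<in> Poly_Mapping.keys f" "\<forall>k\<in>Poly_Mapping.keys f. r k \<le> r a"
    using max[OF assms(1)] by blast
  obtain b where b: "b \<in> Poly_Mapping.keys g" "\<forall>k\<in>Poly_Mapping.keys g. r k \<le> r b"
    using max[OF assms(2)] by blast
  have "Poly_Mapping.lookup (f * g) (a + b) = Poly_Mapping.lookup f a * Poly_Mapping.lookup g b"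
  proof (rule lookup_times_unique_sum)
    fix k l assume kl: "k \<in> Poly_Mapping.keys f" "l \<in> Poly_Mapping.keys g" "k + l = a + b"
    have "r k \<le> r a" "r l \<le> r b" using a b kl by auto
    moreover have "r k + r l = r a + r b" using kl(3) r(2) by metis
    ultimately have "r k = r a"
      by (metis add_less_le_mono order_less_irrefl order_le_less)
    then have "k = a" using r(1) by (simp add: inj_eq)
    then show "k = a \<and> l = b" using kl(3) by simp
  qed
  also have "\<dots> \<noteq> 0" using a(1) b(1) by (simp add: in_keys_iff)
  finally show ?thesis by auto
qed

instance laurent :: (finite) idom
proof
  fix f g :: "'a laurent"
  assume "f \<noteq> 0" "g \<noteq> 0"
  then show "f * g \<noteq> 0" by transfer (rule laurent_no_zero_divisors)
qed

definition exponents :: "'n::finite laurent \<Rightarrow> (int ^ 'n) set" where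
  "exponents f = Poly_Mapping.keys (poly_of f)"

definition laurent_coeff :: "'n::finite laurent \<Rightarrow> int ^ 'n \<Rightarrow> int" where
  "laurent_coeff f = Poly_Mapping.lookup (poly_of f)"

definition character :: "int ^ 'n \<Rightarrow> 'n::finite laurent" where
  "character m = Laurent (Poly_Mapping.single m 1)"

section \<open>Fans and the coordinate rings of the affine charts\<close>

definition strongly_convex_rational_cone :: "(real ^ 'n) set \<Rightarrow> bool" where
  "strongly_convex_rational_cone \<sigma> \<longleftrightarrow>
     (\<exists>F. finite F \<and> \<sigma> = convex_cone hull (real_vec ` F)) \<and> \<sigma> \<inter> uminus ` \<sigma> = {0}"

text \<open>
  The library counts the empty set as a face; the faces of a cone in the toric sense are the
  nonempty ones. In particular \<open>{0}\<close> belongs to every fan.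
\<close>

definition is_fan :: "(real ^ 'n) set set \<Rightarrow> bool" where
  "is_fan \<Sigma> \<longleftrightarrow>
     finite \<Sigma> \<and> \<Sigma> \<noteq> {} \<and>
     (\<forall>\<sigma>\<in>\<Sigma>. strongly_convex_rational_cone \<sigma>) \<and>
     (\<forall>\<sigma>\<in>\<Sigma>. \<forall>\<tau>. \<tau> face_of \<sigma> \<and> \<tau> \<noteq> {} \<longrightarrow> \<tau> \<in> \<Sigma>) \<and>
     (\<forall>\<sigma>\<in>\<Sigma>. \<forall>\<tau>\<in>\<Sigma>. (\<sigma> \<inter> \<tau>) face_of \<sigma> \<and> (\<sigma> \<inter> \<tau>) face_of \<tau>)"

definition dual_monoid :: "(real ^ 'n) set \<Rightarrow> (int ^ 'n) set" where
  "dual_monoid \<sigma> = {m. \<forall>u\<in>\<sigma>. pairing m u \<ge> 0}"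

definition chart_ring :: "(real ^ 'n::finite) set \<Rightarrow> 'n laurent set" where
  "chart_ring \<sigma> = {f. exponents f \<subseteq> dual_monoid \<sigma>}"

section \<open>Smoothness\<close>

abbreviation subring_record :: "'a::ring_1 set \<Rightarrow> 'a ring" where
  "subring_record A \<equiv> ring_of_type_algebra\<lparr>carrier := A\<rparr>"

definition finite_type_over_Z :: "'a::comm_ring_1 set \<Rightarrow> bool" where
  "finite_type_over_Z A \<longleftrightarrow> (\<exists>F. finite F \<and> F \<subseteq> A \<and> generate_ring ring_of_type_algebra F = A)"

text \<open>
  Infinitesimal lifting property. For \<open>A = \<int>[x\<^sub>1, \<dots>, x\<^sub>n] / J\<close> it is enough to
  test it on \<open>B = \<int>[x\<^sub>1, \<dots>, x\<^sub>n] / J\<^sup>2\<close>, which is countable; hence test rings with carrier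
  in \<open>nat\<close> suffice.
\<close>

definition formally_smooth_over_Z :: "'a::comm_ring_1 set \<Rightarrow> bool" where
  "formally_smooth_over_Z A \<longleftrightarrow>
     (\<forall>(B :: nat ring) I.
        cring B \<and> ideal I B \<and> (\<forall>a\<in>I. \<forall>b\<in>I. a \<otimes>\<^bsub>B\<^esub> b = \<zero>\<^bsub>B\<^esub>) \<longrightarrow>
        (\<forall>\<phi> \<in> ring_hom (subring_record A) (B Quot I).
           \<exists>\<theta> \<in> ring_hom (subring_record A) B. \<forall>a\<in>A. \<phi> a = I +>\<^bsub>B\<^esub> \<theta> a))"

text \<open>
  Smooth means formally smooth and locally of finite presentation, and over the
  Noetherian base \<open>\<int>\<close> finite presentation is the same as finite type.
\<close>

definition smooth_toric :: "(real ^ 'n::finite) set set \<Rightarrow> bool" where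
  "smooth_toric \<Sigma> \<longleftrightarrow>
     (\<forall>\<sigma>\<in>\<Sigma>. finite_type_over_Z (chart_ring \<sigma>) \<and> formally_smooth_over_Z (chart_ring \<sigma>))"

section \<open>Projectivity\<close>

text \<open>
  An integral separated scheme of finite type over \<open>\<int>\<close> with function field \<open>K\<close> is determined, together with
  the identification of its function field, by the set of its local rings inside \<open>K\<close> (Chevalley schemes,
  EGA I, section 8). A closed integral subscheme of projective \<open>N\<close>-space over \<open>\<int>\<close> with function
  field \<open>K\<close>, contained in no coordinate hyperplane, is given by the restrictions \<open>f\<^sub>0, \<dots>, f\<^sub>N\<close> of the homogeneous
  coordinates, which are elements of \<open>K\<^sup>*\<close> up to a common factor; its standard affine
  charts are the spectra of the rings \<open>\<int>[f\<^sub>0 / f\<^sub>i, \<dots>, f\<^sub>N / f\<^sub>i]\<close>. Coordinates vanishing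
  identically on the subscheme can be dropped. So the toric scheme is projective over \<open>\<int>\<close> if and only if it
  has the same local rings as some such subscheme.
\<close>

definition local_rings :: "'k::field set \<Rightarrow> 'k set set" where
  "local_rings A =
     {{a / b | a b. a \<in> A \<and> b \<in> A - p} | p. primeideal p (subring_record A)}"

definition function_field_ring :: "(real ^ 'n::finite) set \<Rightarrow> 'n laurent fract set" where
  "function_field_ring \<sigma> = (\<lambda>f. Fract f 1) ` chart_ring \<sigma>"

definition projective_toric :: "(real ^ 'n::finite) set set \<Rightarrow> bool" where
  "projective_toric \<Sigma> \<longleftrightarrow>
     (\<exists>(N::nat) (f :: nat \<Rightarrow> 'n laurent fract).
        (\<forall>i\<le>N. f i \<noteq> 0) \<and>
        (\<Union>\<sigma>\<in>\<Sigma>. local_rings (function_field_ring \<sigma>)) =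
        (\<Union>i\<in>{..N}. local_rings (generate_ring ring_of_type_algebra {f j / f i | j. j \<le> N})))"

section \<open>Complex points\<close>

text \<open>
  A complex point of the chart of \<open>\<sigma>\<close> is a ring homomorphism \<open>\<int>[P \<inter> \<sigma>\<^sup>*] \<rightarrow> \<complex>\<close>, that is
  a monoid homomorphism from \<open>P \<inter> \<sigma>\<^sup>*\<close> to \<open>(\<complex>, \<cdot>)\<close>; it is extended by \<open>0\<close> to all of \<open>P\<close> to make
  it a unique function. The analytic topology on the chart is the topology of pointwise convergence,
  that is the one induced by the product topology on \<open>int ^ 'n \<Rightarrow> complex\<close>.
\<close>

definition chart_points :: "(real ^ 'n) set \<Rightarrow> (int ^ 'n \<Rightarrow> complex) set" where
  "chart_points \<sigma> =
     {x. x 0 = 1 \<and>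
         (\<forall>m\<in>dual_monoid \<sigma>. \<forall>m'\<in>dual_monoid \<sigma>. x (m + m') = x m * x m') \<and>
         (\<forall>m. m \<notin> dual_monoid \<sigma> \<longrightarrow> x m = 0)}"

text \<open>
  \<open>glued_via \<sigma> x \<tau> y z\<close>: the points \<open>x\<close> and \<open>y\<close> of the charts of \<open>\<sigma>\<close> and \<open>\<tau>\<close> are both the image
  of the point \<open>z\<close> of the chart of \<open>\<sigma> \<inter> \<tau>\<close>, hence are the same point of \<open>X(\<complex>)\<close>.
\<close>

definition glued_via ::
  "(real ^ 'n) set \<Rightarrow> (int ^ 'n \<Rightarrow> complex) \<Rightarrow> (real ^ 'n) set \<Rightarrow> (int ^ 'n \<Rightarrow> complex) \<Rightarrow>
   (int ^ 'n \<Rightarrow> complex) \<Rightarrow> bool" where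
  "glued_via \<sigma> x \<tau> y z \<longleftrightarrow>
     x \<in> chart_points \<sigma> \<and> y \<in> chart_points \<tau> \<and> z \<in> chart_points (\<sigma> \<inter> \<tau>) \<and>
     (\<forall>m\<in>dual_monoid \<sigma>. x m = z m) \<and> (\<forall>m\<in>dual_monoid \<tau>. y m = z m)"

text \<open>
  The disjoint union of the charts, of which \<open>X(\<complex>)\<close> is the quotient by gluing. Functions on
  \<open>X(\<complex>)\<close> are the functions on this set that respect \<open>glued_via\<close>.
\<close>

definition charted_points :: "(real ^ 'n) set set \<Rightarrow> ((real ^ 'n) set \<times> (int ^ 'n \<Rightarrow> complex)) set" where
  "charted_points \<Sigma> = (SIGMA \<sigma>:\<Sigma>. chart_points \<sigma>)"

definition compact_torus :: "(int ^ 'n \<Rightarrow> complex) set" where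
  "compact_torus = {t. (\<forall>m m'. t (m + m') = t m * t m') \<and> (\<forall>m. cmod (t m) = 1)}"

definition torus_exp_neg :: "real ^ 'n \<Rightarrow> int ^ 'n \<Rightarrow> complex" where
  "torus_exp_neg u = (\<lambda>m. exp (- complex_of_real (pairing m u)))"

section \<open>Equivariant divisors, metrics and sections\<close>

text \<open>\<open>\<mu> \<sigma>\<close> is \<open>m\<^sub>\<sigma>\<close>; it is determined by \<open>\<psi>\<close> only up to the orthogonal of \<open>\<sigma>\<close>.\<close>

definition equivariant_divisor ::
  "(real ^ 'n) set set \<Rightarrow> (real ^ 'n \<Rightarrow> real) \<Rightarrow> ((real ^ 'n) set \<Rightarrow> int ^ 'n) \<Rightarrow> bool" where
  "equivariant_divisor \<Sigma> \<psi> \<mu> \<longleftrightarrow>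
     continuous_on UNIV \<psi> \<and> (\<forall>\<sigma>\<in>\<Sigma>. \<forall>u\<in>\<sigma>. \<psi> u = pairing (\<mu> \<sigma>) u)"

definition divisor_polytope :: "(real ^ 'n \<Rightarrow> real) \<Rightarrow> (real ^ 'n) set" where
  "divisor_polytope \<psi> = {x. \<forall>u. x \<bullet> u \<ge> \<psi> u}"

text \<open>
  On the chart of \<open>\<sigma>\<close>, the line bundle \<open>\<O>(D)\<close> has the frame \<open>e\<^sub>\<sigma>\<close>, the character of exponent \<open>m\<^sub>\<sigma>\<close>, that is
  the inverse of the local equation of \<open>D\<close>. A metric is given by the functions \<open>h \<sigma> x = \<parallel>e\<^sub>\<sigma>(x)\<parallel>\<close>;
  the transition rule expresses that \<open>e\<^sub>\<tau>\<close> is \<open>e\<^sub>\<sigma>\<close> times the character of exponent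
  \<open>m\<^sub>\<tau> - m\<^sub>\<sigma>\<close>, which is invertible on the overlap. On a complex line every norm comes from a
  hermitian form.
\<close>

definition continuous_hermitian_metric ::
  "(real ^ 'n) set set \<Rightarrow> ((real ^ 'n) set \<Rightarrow> int ^ 'n) \<Rightarrow>
   ((real ^ 'n) set \<Rightarrow> (int ^ 'n \<Rightarrow> complex) \<Rightarrow> real) \<Rightarrow> bool" where
  "continuous_hermitian_metric \<Sigma> \<mu> h \<longleftrightarrow>
     (\<forall>\<sigma>\<in>\<Sigma>. continuous_on (chart_points \<sigma>) (h \<sigma>) \<and> (\<forall>x\<in>chart_points \<sigma>. h \<sigma> x > 0)) \<and>
     (\<forall>\<sigma>\<in>\<Sigma>. \<forall>\<tau>\<in>\<Sigma>. \<forall>x y z. glued_via \<sigma> x \<tau> y z \<longrightarrow>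
        h \<tau> y = cmod (z (\<mu> \<tau> - \<mu> \<sigma>)) * h \<sigma> x)"

text \<open>
  The torus acts on \<open>\<O>(D)\<close> fixing the section \<open>s_D\<close>, so that \<open>t\<close> maps \<open>e\<^sub>\<sigma>(x)\<close> to
  \<open>e\<^sub>\<sigma>(t x)\<close> times a character value, which has modulus 1 for \<open>t\<close> in the compact torus.
\<close>

definition compact_torus_invariant ::
  "(real ^ 'n) set set \<Rightarrow> ((real ^ 'n) set \<Rightarrow> (int ^ 'n \<Rightarrow> complex) \<Rightarrow> real) \<Rightarrow> bool" where
  "compact_torus_invariant \<Sigma> h \<longleftrightarrow>
     (\<forall>\<sigma>\<in>\<Sigma>. \<forall>x\<in>chart_points \<sigma>. \<forall>t\<in>compact_torus. h \<sigma> (\<lambda>m. t m * x m) = h \<sigma> x)"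

definition laurent_eval :: "'n::finite laurent \<Rightarrow> (int ^ 'n \<Rightarrow> complex) \<Rightarrow> complex" where
  "laurent_eval f x = (\<Sum>m\<in>exponents f. of_int (laurent_coeff f m) * x m)"

text \<open>
  Sections of \<open>\<O>(l D)\<close> are viewed as rational functions: over the chart of \<open>\<sigma>\<close> they form the
  free module generated by \<open>e\<^sub>\<sigma>\<^sup>l\<close>, the character of exponent \<open>l m\<^sub>\<sigma>\<close>. The chart of
  \<open>{0}\<close> being the torus, global sections are Laurent polynomials.
\<close>

definition global_sections ::
  "(real ^ 'n::finite) set set \<Rightarrow> ((real ^ 'n) set \<Rightarrow> int ^ 'n) \<Rightarrow> nat \<Rightarrow> 'n laurent set" where
  "global_sections \<Sigma> \<mu> l =
     {s. \<forall>\<sigma>\<in>\<Sigma>. \<exists>f\<in>chart_ring \<sigma>. s = f * character (of_nat l *s \<mu> \<sigma>)}"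

text \<open>
  Norm of the section \<open>s\<close> of \<open>\<O>(l D)\<close> at the point \<open>x\<close> of the chart of \<open>\<sigma>\<close>, for the \<open>l\<close>-th tensor
  power metric, when \<open>s\<close> is regular on that chart.
\<close>

definition section_norm ::
  "((real ^ 'n::finite) set \<Rightarrow> int ^ 'n) \<Rightarrow> ((real ^ 'n) set \<Rightarrow> (int ^ 'n \<Rightarrow> complex) \<Rightarrow> real) \<Rightarrow>
   nat \<Rightarrow> 'n laurent \<Rightarrow> (real ^ 'n) set \<Rightarrow> (int ^ 'n \<Rightarrow> complex) \<Rightarrow> real" where
  "section_norm \<mu> h l s \<sigma> x =
     cmod (laurent_eval (s * character (- (of_nat l *s \<mu> \<sigma>))) x) * h \<sigma> x ^ l"

definition sup_norm ::
  "(real ^ 'n::finite) set set \<Rightarrow> ((real ^ 'n) set \<Rightarrow> int ^ 'n) \<Rightarrow>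
   ((real ^ 'n) set \<Rightarrow> (int ^ 'n \<Rightarrow> complex) \<Rightarrow> real) \<Rightarrow> nat \<Rightarrow> 'n laurent \<Rightarrow> ereal" where
  "sup_norm \<Sigma> \<mu> h l s = (SUP (\<sigma>, x)\<in>charted_points \<Sigma>. ereal (section_norm \<mu> h l s \<sigma> x))"

definition small_sections ::
  "(real ^ 'n::finite) set set \<Rightarrow> ((real ^ 'n) set \<Rightarrow> int ^ 'n) \<Rightarrow>
   ((real ^ 'n) set \<Rightarrow> (int ^ 'n \<Rightarrow> complex) \<Rightarrow> real) \<Rightarrow> nat \<Rightarrow> 'n laurent set" where
  "small_sections \<Sigma> \<mu> h l = {s \<in> global_sections \<Sigma> \<mu> l. sup_norm \<Sigma> \<mu> h l s \<le> 1}"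

definition arithmetic_volume ::
  "(real ^ 'n::finite) set set \<Rightarrow> ((real ^ 'n) set \<Rightarrow> int ^ 'n) \<Rightarrow>
   ((real ^ 'n) set \<Rightarrow> (int ^ 'n \<Rightarrow> complex) \<Rightarrow> real) \<Rightarrow> ereal" where
  "arithmetic_volume \<Sigma> \<mu> h =
     limsup (\<lambda>l. ereal (ln (real (card (small_sections \<Sigma> \<mu> h l))) /
                        (real l ^ (CARD('n) + 1) / fact (CARD('n) + 1))))"

section \<open>The function attached to the metric and its Legendre-Fenchel transform\<close>

text \<open>
  The section \<open>s_D\<close> corresponds to the rational function 1, and the torus is the chart of \<open>{0}\<close>.
\<close>

definition g_metric ::
  "((real ^ 'n::finite) set \<Rightarrow> int ^ 'n) \<Rightarrow> ((real ^ 'n) set \<Rightarrow> (int ^ 'n \<Rightarrow> complex) \<Rightarrow> real) \<Rightarrow>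
   real ^ 'n \<Rightarrow> real" where
  "g_metric \<mu> h u = ln (section_norm \<mu> h 1 1 {0} (torus_exp_neg u))"

definition legendre_fenchel :: "(real ^ 'n \<Rightarrow> real) \<Rightarrow> real ^ 'n \<Rightarrow> ereal" where
  "legendre_fenchel g x = (INF u. ereal (x \<bullet> u - g u))"

definition theta_set :: "(real ^ 'n \<Rightarrow> real) \<Rightarrow> (real ^ 'n \<Rightarrow> real) \<Rightarrow> (real ^ 'n) set" where
  "theta_set \<psi> g = {x \<in> divisor_polytope \<psi>. legendre_fenchel g x \<ge> 0}"

end

(*
  Let g be the function of the metric on the torus and g^ its Legendre-Fenchel transform.

  Fourier analysis on the compact torus bounds every coefficient of a small section of O(lD) by
  exp (l g^(m/l)), m the exponent. Conversely a Laurent polynomial whose coefficients are at most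
  exp (l g^(m/l)) / N, with N the number of lattice points of l Theta, is small, since the torus is
  dense in X(C) and so the sup norm of the character of exponent m is at most exp (- l g^(m/l)).
  Up to a factor exp (O(l^d log l)) the number of small sections is therefore the product of
  exp (l g^(m/l)) over the lattice points m of l Theta, and the sum of g^(m/l) is a Riemann sum.

  The fan is complete by the valuative criterion of properness.
*)

theory Submission
  imports Defs
begin

unbundle no fps_syntax

section \<open>Riemann sums over lattices\<close>

text \<open>The set \<Theta> comes from integrality: a nonzero integer coefficient has modulus at
  least 1, so the Fourier bound for the exponent m forces the transform to be nonnegative at m/l,
  and exponents outside l \<Theta> cannot occur. Both estimates then count integer points of a box
  indexed by the lattice points of l \<Theta>. The loss per lattice point is ln 3 above and ln N
  below; as N = O(l^d), both vanish against l^(d+1), and the limsup is a limit.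

  Three obstacles shape the rest. Cut off to \<Theta>, the transform may jump at the frontier, so
  Riemann sums are treated for almost everywhere continuous functions; concavity gives continuity
  inside, and the frontier of a convex set is null. The function g controls the metric on the torus
  alone, so the other points of a chart must be limits of torus points, which requires extending
  characters from a submonoid to the whole lattice. Projectivity is expressed by local rings in the
  function field, so completeness is derived from valuations of that field, with arbitrary real
  weights u, and a cone has to be recovered from the integral points of its dual.\<close>

lemma real_vec_nth [simp]: "real_vec m $ i = real_of_int (m $ i)"
  by (simp add: real_vec_def)

lemma finite_bounded_int_vecs: "finite {m :: int ^ 'n::finite. \<forall>i. \<bar>m $ i\<bar> \<le> B}"
proof -
  have "finite (vec_lambda ` (UNIV \<rightarrow>\<^sub>E {-B..B}) :: (int ^ 'n) set)"
    by (intro finite_imageI finite_PiE) auto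
  moreover have "{m :: int ^ 'n. \<forall>i. \<bar>m $ i\<bar> \<le> B} \<subseteq> vec_lambda ` (UNIV \<rightarrow>\<^sub>E {-B..B})"
  proof
    fix m :: "int ^ 'n" assume "m \<in> {m. \<forall>i. \<bar>m $ i\<bar> \<le> B}"
    then have "m = vec_lambda (vec_nth m)" "vec_nth m \<in> UNIV \<rightarrow>\<^sub>E {-B..B}"
      by (auto simp: abs_le_iff minus_le_iff)
    then show "m \<in> vec_lambda ` (UNIV \<rightarrow>\<^sub>E {-B..B})" by (rule image_eqI)
  qed
  ultimately show ?thesis by (rule rev_finite_subset)
qed

lemma lattice_points_bound:
  fixes m :: "int ^ 'n::finite"
  assumes "l > 0" "\<And>x. x \<in> A \<Longrightarrow> norm x \<le> R" "real_vec m /\<^sub>R real l \<in> A"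
  shows "\<bar>m $ i\<bar> \<le> \<lceil>real l * R\<rceil>"
proof -
  have "\<bar>real_of_int (m $ i)\<bar> / real l = \<bar>(real_vec m /\<^sub>R real l) $ i\<bar>"
    by (simp add: abs_mult field_simps)
  also have "\<dots> \<le> R"
    using component_le_norm_cart[of "real_vec m /\<^sub>R real l" i] assms(2,3) by fastforce
  finally have "real_of_int \<bar>m $ i\<bar> \<le> real l * R"
    using assms(1) by (simp add: field_simps)
  then show ?thesis by linarith
qed

lemma finite_lattice_points:
  fixes A :: "(real ^ 'n::finite) set"
  assumes "bounded A" "l > 0"
  shows "finite {m. real_vec m /\<^sub>R real l \<in> A}"
proof -
  obtain R where R: "\<And>x. x \<in> A \<Longrightarrow> norm x \<le> R"
    using assms(1) by (auto simp: bounded_iff)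
  show ?thesis
    by (rule finite_subset[OF _ finite_bounded_int_vecs[of "\<lceil>real l * R\<rceil>"]])
      (use lattice_points_bound[OF assms(2) R] in auto)
qed

text \<open>With floors the cubes of side 1/l are half-open and partition the space, so each x
  selects exactly one lattice point.\<close>

definition grid_cube :: "nat \<Rightarrow> int ^ 'n \<Rightarrow> (real ^ 'n) set" where
  "grid_cube l m = {x. \<forall>i. m $ i = \<lfloor>real l * x $ i\<rfloor>}"

lemma grid_cube_bounds:
  fixes m :: "int ^ 'n::finite"
  assumes "l > 0"
  shows "box (real_vec m /\<^sub>R real l) ((real_vec m + 1) /\<^sub>R real l) \<subseteq> grid_cube l m"
    and "grid_cube l m \<subseteq> cbox (real_vec m /\<^sub>R real l) ((real_vec m + 1) /\<^sub>R real l)"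
proof -
  have *: "m $ i = \<lfloor>real l * y\<rfloor> \<longleftrightarrow> real_of_int (m $ i) / real l \<le> y \<and> y < (real_of_int (m $ i) + 1) / real l" for i y
    using assms by (simp add: eq_commute[of "m $ i"] floor_eq_iff field_simps)
  show "box (real_vec m /\<^sub>R real l) ((real_vec m + 1) /\<^sub>R real l) \<subseteq> grid_cube l m"
    by (auto simp: mem_box_cart grid_cube_def * divide_inverse_commute less_imp_le)
  show "grid_cube l m \<subseteq> cbox (real_vec m /\<^sub>R real l) ((real_vec m + 1) /\<^sub>R real l)"
    by (auto simp: mem_box_cart grid_cube_def * divide_inverse_commute less_imp_le)
qed

lemma grid_cube_measurable [measurable]: "grid_cube l m \<in> sets borel"
  for m :: "int ^ 'n::finite"
proof -
  have "grid_cube l m = (\<Inter>i\<in>UNIV. {x\<in>space borel. m $ i = \<lfloor>real l * x $ i\<rfloor>})"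
    by (auto simp: grid_cube_def)
  also have "\<dots> \<in> sets borel"
    by (intro sets.finite_INT) auto
  finally show ?thesis .
qed

lemma prod_vec_Basis: "(\<Prod>b\<in>Basis. x \<bullet> b) = (\<Prod>i\<in>UNIV. x $ i)" for x :: "real ^ 'n::finite"
proof -
  have "(\<Prod>b\<in>Basis. x \<bullet> b) = (\<Prod>b\<in>range (\<lambda>i. axis i 1). x \<bullet> b)"
    by (rule prod.cong) (auto simp: Basis_vec_def)
  also have "\<dots> = (\<Prod>i\<in>UNIV. x $ i)"
    by (subst prod.reindex) (auto simp: inj_on_def axis_eq_axis inner_axis)
  finally show ?thesis .
qed

text \<open>The open and the closed box enclosing the half-open cube have the same volume.\<close>

lemma measure_grid_cube:
  fixes m :: "int ^ 'n::finite"
  assumes "l > 0"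
  shows "emeasure lborel (grid_cube l m) = ennreal (1 / real l ^ CARD('n))"
proof (rule antisym)
  let ?a = "real_vec m /\<^sub>R real l" and ?b = "(real_vec m + 1) /\<^sub>R real l"
  have d: "?b - ?a = (\<chi> i. 1 / real l)"
    by (simp add: vec_eq_iff algebra_simps divide_inverse)
  have le: "?a \<bullet> b \<le> ?b \<bullet> b" if "b \<in> Basis" for b
    using that by (auto simp: Basis_vec_def inner_axis field_simps)
  have prd: "(\<Prod>b\<in>Basis. (?b - ?a) \<bullet> b) = 1 / real l ^ CARD('n)"
    unfolding prod_vec_Basis unfolding d by (simp add: power_divide)
  have "emeasure lborel (grid_cube l m) \<le> emeasure lborel (cbox ?a ?b)"
    by (intro emeasure_mono grid_cube_bounds assms) auto
  also have "\<dots> = ennreal (1 / real l ^ CARD('n))"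
    by (subst emeasure_lborel_cbox[OF le]) (use prd in auto)
  finally show "emeasure lborel (grid_cube l m) \<le> ennreal (1 / real l ^ CARD('n))" .
  have "ennreal (1 / real l ^ CARD('n)) = emeasure lborel (box ?a ?b)"
    by (subst emeasure_lborel_box[OF le]) (use prd in auto)
  also have "\<dots> \<le> emeasure lborel (grid_cube l m)"
    by (intro emeasure_mono grid_cube_bounds assms) auto
  finally show "ennreal (1 / real l ^ CARD('n)) \<le> emeasure lborel (grid_cube l m)" .
qed

lemma floor_vec_near:
  fixes x :: "real ^ 'n::finite"
  assumes "l > 0"
  shows "\<bar>(real_vec (\<chi> i. \<lfloor>real l * x $ i\<rfloor>) /\<^sub>R real l) $ i - x $ i\<bar> \<le> 1 / real l"
proof -
  have "\<bar>real_of_int \<lfloor>real l * x $ i\<rfloor> - real l * x $ i\<bar> \<le> 1" by linarith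
  then have "\<bar>real_of_int \<lfloor>real l * x $ i\<rfloor> - real l * x $ i\<bar> / real l \<le> 1 / real l"
    by (intro divide_right_mono) auto
  moreover have "\<bar>real_of_int \<lfloor>real l * x $ i\<rfloor> - real l * x $ i\<bar> / real l =
      \<bar>(real_of_int \<lfloor>real l * x $ i\<rfloor> - real l * x $ i) / real l\<bar>" by simp
  moreover have "(real_of_int \<lfloor>real l * x $ i\<rfloor> - real l * x $ i) / real l =
      (real_vec (\<chi> i. \<lfloor>real l * x $ i\<rfloor>) /\<^sub>R real l) $ i - x $ i"
    using assms by (simp add: field_simps)
  ultimately show ?thesis by metis
qed

text \<open>Besides serving the Riemann sums, this approximates a real functional by rational ones
  in \<open>cone_bidual\<close>.\<close>

lemma floor_vec_tendsto:
  fixes x :: "real ^ 'n::finite"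
  shows "(\<lambda>l. real_vec (\<chi> i. \<lfloor>real l * x $ i\<rfloor>) /\<^sub>R real l) \<longlonglongrightarrow> x"
    (is "?r \<longlonglongrightarrow> x")
proof (rule vec_tendstoI)
  fix i
  have "(\<lambda>l. ?r l $ i - x $ i) \<longlonglongrightarrow> 0"
  proof (rule Lim_null_comparison)
    show "\<forall>\<^sub>F l in sequentially. norm (?r l $ i - x $ i) \<le> 1 / real l"
      using eventually_gt_at_top[of 0] by eventually_elim (use floor_vec_near in auto)
    show "(\<lambda>l. 1 / real l) \<longlonglongrightarrow> 0" by (rule lim_const_over_n)
  qed
  then show "(\<lambda>l. ?r l $ i) \<longlonglongrightarrow> x $ i"
    by (rule LIM_zero_cancel)
qed

text \<open>The sum is the integral of the step function \<open>F l\<close>, which samples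
  \<open>f\<close> at x rounded down to the lattice of mesh 1/l. It converges to \<open>f\<close> at
  every continuity point, and dominated convergence does the rest.\<close>

lemma lattice_riemann_sum:
  fixes f :: "real ^ 'n::finite \<Rightarrow> real"
  assumes bd: "bounded A" and supp: "\<And>x. x \<notin> A \<Longrightarrow> f x = 0"
    and B: "\<And>x. \<bar>f x\<bar> \<le> B" and meas [measurable]: "f \<in> borel_measurable borel"
    and cont: "AE x in lborel. isCont f x"
  shows "(\<lambda>l. (\<Sum>m | real_vec m /\<^sub>R real l \<in> A. f (real_vec m /\<^sub>R real l)) / real l ^ CARD('n))
           \<longlonglongrightarrow> integral\<^sup>L lborel f"
proof -
  obtain R where R: "\<And>x. x \<in> A \<Longrightarrow> norm x \<le> R"
    using bd by (auto simp: bounded_iff)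
  define M where "M l = {m. real_vec m /\<^sub>R real l \<in> A}" for l
  define r where "r l x = (\<chi> i. \<lfloor>real l * x $ i\<rfloor>)" for l and x :: "real ^ 'n"
  define F where "F l x = (\<Sum>m\<in>M l. f (real_vec m /\<^sub>R real l) * indicator (grid_cube l m) x)" for l x
  \<comment> \<open>Rounding moves a coordinate by at most 1/l, hence by at most 1, so
    \<open>C\<close> contains the supports of all the step functions with positive l.\<close>
  define C :: "(real ^ 'n) set" where "C = cbox (\<chi> i. - (R + 1)) (\<chi> i. R + 1)"
  have B0: "B \<ge> 0" using B[of 0] by linarith
  have fin: "finite (M l)" if "l > 0" for l
    unfolding M_def using finite_lattice_points[OF bd that] .
  have mem: "x \<in> grid_cube l m \<longleftrightarrow> m = r l x" for x l m
    by (auto simp: grid_cube_def r_def vec_eq_iff)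
  have F_eq: "F l x = f (real_vec (r l x) /\<^sub>R real l)" if "l > 0" for l x
  proof -
    have "F l x = (\<Sum>m\<in>M l. if m = r l x then f (real_vec m /\<^sub>R real l) else 0)"
      unfolding F_def by (rule sum.cong) (auto simp: mem indicator_def)
    also have "\<dots> = f (real_vec (r l x) /\<^sub>R real l)"
      using fin[OF that] supp by (auto simp: M_def)
    finally show ?thesis .
  qed
  have int_F: "integral\<^sup>L lborel (F l) = (\<Sum>m\<in>M l. f (real_vec m /\<^sub>R real l)) / real l ^ CARD('n)" if "l > 0" for l
  proof -
    have "integral\<^sup>L lborel (F l) =
        (\<Sum>m\<in>M l. \<integral>x. f (real_vec m /\<^sub>R real l) * indicator (grid_cube l m) x \<partial>lborel)"
      unfolding F_def
      by (rule Bochner_Integration.integral_sum)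
        (use that in \<open>auto intro!: integrable_real_indicator simp: measure_grid_cube\<close>)
    also have "\<dots> = (\<Sum>m\<in>M l. f (real_vec m /\<^sub>R real l) / real l ^ CARD('n))"
      using that by (intro sum.cong refl) (simp add: measure_def measure_grid_cube)
    finally show ?thesis by (simp add: sum_divide_distrib)
  qed
  \<comment> \<open>The shift to \<open>Suc l\<close> removes l = 0, where there is no grid; the
    domination is needed for every index.\<close>
  have "(\<lambda>l. integral\<^sup>L lborel (F (Suc l))) \<longlonglongrightarrow> integral\<^sup>L lborel f"
  proof (rule integral_dominated_convergence[where w = "\<lambda>x. B * indicator C x"])
    show "f \<in> borel_measurable lborel" by simp
    show "F (Suc l) \<in> borel_measurable lborel" for l
      unfolding F_def by simp
    show "integrable lborel (\<lambda>x. B * indicator C x)"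
      unfolding C_def
      by (intro integrable_mult_right integrable_real_indicator emeasure_lborel_cbox_finite) simp
    show "AE x in lborel. (\<lambda>l. F (Suc l) x) \<longlonglongrightarrow> f x"
      using cont
    proof eventually_elim
      case (elim x)
      have "(\<lambda>l. f (real_vec (r (Suc l) x) /\<^sub>R real (Suc l))) \<longlonglongrightarrow> f x"
        using isCont_tendsto_compose[OF elim LIMSEQ_Suc[OF floor_vec_tendsto]] by (simp add: r_def)
      then show ?case by (simp only: F_eq[OF zero_less_Suc])
    qed
    show "AE x in lborel. norm (F (Suc l) x) \<le> B * indicator C x" for l
    proof (rule AE_I2)
      fix x
      let ?y = "real_vec (r (Suc l) x) /\<^sub>R real (Suc l)"
      show "norm (F (Suc l) x) \<le> B * indicator C x"
      proof (cases "?y \<in> A")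
        case True
        have "\<bar>x $ i\<bar> \<le> R + 1" for i
        proof -
          have "\<bar>?y $ i\<bar> \<le> R" using component_le_norm_cart[of ?y i] R[OF True] by linarith
          moreover have "\<bar>?y $ i - x $ i\<bar> \<le> 1"
            using floor_vec_near[of "Suc l" x i] unfolding r_def by (rule order_trans) auto
          ultimately show ?thesis by linarith
        qed
        then have "- (R + 1) \<le> x $ i \<and> x $ i \<le> R + 1" for i
          by (metis abs_le_iff minus_le_iff)
        then have "x \<in> C" by (simp add: C_def mem_box_cart)
        then show ?thesis using B by (simp only: F_eq[OF zero_less_Suc]) simp
      next
        case False
        then show ?thesis using B0 supp by (simp only: F_eq[OF zero_less_Suc]) simp
      qed
    qed
  qed
  then have "(\<lambda>l. (\<Sum>m\<in>M (Suc l). f (real_vec m /\<^sub>R real (Suc l))) / real (Suc l) ^ CARD('n))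
      \<longlonglongrightarrow> integral\<^sup>L lborel f"
    by (simp only: int_F[OF zero_less_Suc])
  then show ?thesis
    unfolding M_def by (rule LIMSEQ_imp_Suc)
qed

section \<open>The Legendre-Fenchel transform on its superlevel sets\<close>

text \<open>\<Theta> is the level 0; the positive levels serve to prove measurability.\<close>

definition superlevel :: "(real ^ 'n \<Rightarrow> real) \<Rightarrow> (real ^ 'n) set \<Rightarrow> real \<Rightarrow> (real ^ 'n) set" where
  "superlevel g K c = {x \<in> K. legendre_fenchel g x \<ge> ereal c}"

text \<open>An infimum is at least c exactly if every term is, so the set is cut out of
  \<open>K\<close> by closed half-spaces; closedness and convexity follow.\<close>

lemma superlevel_altdef: "superlevel g K c = K \<inter> (\<Inter>u. {x. x \<bullet> u \<ge> g u + c})"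
  by (auto simp: superlevel_def legendre_fenchel_def le_INF_iff algebra_simps le_diff_eq)

lemma closed_superlevel: "closed K \<Longrightarrow> closed (superlevel g K c)"
  for K :: "(real ^ 'n::finite) set"
  unfolding superlevel_altdef
  by (intro closed_Int closed_INT ballI)
    (auto intro!: closed_Collect_le continuous_intros)

lemma convex_superlevel: "convex K \<Longrightarrow> convex (superlevel g K c)"
  for K :: "(real ^ 'n::finite) set"
  unfolding superlevel_altdef
  by (intro convex_Int convex_INT) (auto simp: inner_commute[of _ "_ :: real ^ 'n"] convex_halfspace_ge)

lemma legendre_fenchel_le: "legendre_fenchel g x \<le> ereal (x \<bullet> u - g u)"
  unfolding legendre_fenchel_def by (rule INF_lower) simp

text \<open>The hypothesis excludes minus infinity, and the term at u = 0 excludes plus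
  infinity.\<close>

lemma legendre_fenchel_real:
  assumes "legendre_fenchel g x \<ge> 0"
  shows "ereal (real_of_ereal (legendre_fenchel g x)) = legendre_fenchel g x"
  using assms legendre_fenchel_le[of g x 0] by (cases "legendre_fenchel g x") auto

lemma legendre_fenchel_real_le:
  assumes "legendre_fenchel g x \<ge> 0"
  shows "real_of_ereal (legendre_fenchel g x) \<le> x \<bullet> u - g u"
  using legendre_fenchel_le[of g x u] legendre_fenchel_real[OF assms] by (metis ereal_less_eq(3))

lemma legendre_fenchel_real_ge:
  assumes "legendre_fenchel g x \<ge> 0" "\<And>u. c \<le> x \<bullet> u - g u"
  shows "c \<le> real_of_ereal (legendre_fenchel g x)"
proof -
  have "ereal c \<le> legendre_fenchel g x"
    unfolding legendre_fenchel_def by (intro INF_greatest) (simp add: assms(2))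
  then show ?thesis using legendre_fenchel_real[OF assms(1)] by (metis ereal_less_eq(3))
qed

text \<open>An infimum of affine functions is concave. The restriction to level 0 keeps it finite,
  so that \<open>real_of_ereal\<close> does not distort it.\<close>

lemma legendre_fenchel_real_concave:
  fixes K :: "(real ^ 'n::finite) set"
  assumes "convex K"
  shows "concave_on (superlevel g K 0) (\<lambda>x. real_of_ereal (legendre_fenchel g x))"
  unfolding concave_on_iff
proof (intro conjI ballI allI impI)
  show cv: "convex (superlevel g K 0)" by (rule convex_superlevel[OF assms])
  fix x y and a b :: real
  assume xy: "x \<in> superlevel g K 0" "y \<in> superlevel g K 0" and ab: "0 \<le> a" "0 \<le> b" "a + b = 1"
  let ?f = "\<lambda>x. real_of_ereal (legendre_fenchel g x)"
  have z: "a *\<^sub>R x + b *\<^sub>R y \<in> superlevel g K 0" using cv xy ab by (auto simp: convex_def)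
  show "?f (a *\<^sub>R x + b *\<^sub>R y) \<ge> a * ?f x + b * ?f y"
  proof (rule legendre_fenchel_real_ge)
    show "legendre_fenchel g (a *\<^sub>R x + b *\<^sub>R y) \<ge> 0" using z by (simp add: superlevel_def zero_ereal_def)
    fix u
    have "a * ?f x + b * ?f y \<le> a * (x \<bullet> u - g u) + b * (y \<bullet> u - g u)"
      using xy ab
      by (intro add_mono mult_left_mono legendre_fenchel_real_le) (auto simp: superlevel_def zero_ereal_def)
    also have "\<dots> = (a *\<^sub>R x + b *\<^sub>R y) \<bullet> u - (a + b) * g u"
      by (simp add: inner_add_left algebra_simps)
    finally show "a * ?f x + b * ?f y \<le> (a *\<^sub>R x + b *\<^sub>R y) \<bullet> u - g u" using ab by simp
  qed
qed

lemma AE_not_frontier_convex: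
  fixes S :: "(real ^ 'n::finite) set"
  assumes "convex S"
  shows "AE x in lborel. x \<notin> frontier S"
proof -
  have "frontier S \<in> null_sets (completion lborel)"
    using negligible_convex_frontier[OF assms] by (simp add: negligible_iff_null_sets)
  then have "frontier S \<in> null_sets lborel"
    by (subst (asm) null_sets_completion_iff) auto
  then show ?thesis by (rule AE_not_in)
qed

text \<open>Off the frontier, a null set by convexity, a point has a neighbourhood inside
  \<open>S\<close> or one that misses \<open>S\<close>; a jump at the frontier does no harm.\<close>

lemma isCont_restrict_AE:
  fixes S :: "(real ^ 'n::finite) set"
  assumes "convex S" "closed S" "continuous_on (interior S) f"
  shows "AE x in lborel. isCont (\<lambda>x. indicator S x * f x :: real) x"
  using AE_not_frontier_convex[OF assms(1)]
proof eventually_elim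
  case (elim x)
  then consider "x \<in> interior S" | "x \<in> - S"
    using assms(2) by (auto simp: frontier_def closure_closed)
  then show ?case
  proof cases
    case 1
    then have "isCont f x" using assms(3) by (simp add: continuous_on_eq_continuous_at)
    moreover have "\<forall>\<^sub>F y in nhds x. indicator S y * f y = f y"
      using eventually_nhds_in_open[OF open_interior 1]
      by eventually_elim (use interior_subset in \<open>auto simp: indicator_def\<close>)
    ultimately show ?thesis using isCont_cong[of "\<lambda>y. indicator S y * f y" f x] by blast
  next
    case 2
    have "\<forall>\<^sub>F y in nhds x. indicator S y * f y = 0"
      using eventually_nhds_in_open[OF open_Compl[OF assms(2)] 2]
      by eventually_elim (auto simp: indicator_def)
    then show ?thesis using isCont_cong[of "\<lambda>y. indicator S y * f y" "\<lambda>_. 0" x] by simp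
  qed
qed

lemma legendre_fenchel_isCont_AE:
  fixes K :: "(real ^ 'n::finite) set"
  assumes "convex K" "closed K"
  shows "AE x in lborel.
    isCont (\<lambda>x. indicator (superlevel g K 0) x * real_of_ereal (legendre_fenchel g x)) x"
proof (rule isCont_restrict_AE)
  let ?f = "\<lambda>x. real_of_ereal (legendre_fenchel g x)"
  have "convex_on (interior (superlevel g K 0)) (\<lambda>x. - ?f x)"
    using legendre_fenchel_real_concave[OF assms(1)] convex_interior[OF convex_superlevel[OF assms(1)]]
      interior_subset
    unfolding concave_on_def by (metis convex_on_subset)
  then have "continuous_on (interior (superlevel g K 0)) (\<lambda>x. - ?f x)"
    by (intro convex_on_continuous) auto
  then show "continuous_on (interior (superlevel g K 0)) ?f"
    using continuous_on_minus by fastforce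
qed (use assms convex_superlevel closed_superlevel in auto)

text \<open>The cut-off function is nonnegative and upper semicontinuous: the set where it is at
  least c is everything for c \<le> 0 and a closed superlevel set for c > 0.\<close>

lemma legendre_fenchel_measurable:
  fixes K :: "(real ^ 'n::finite) set"
  assumes "closed K"
  shows "(\<lambda>x. indicator (superlevel g K 0) x * real_of_ereal (legendre_fenchel g x)) \<in> borel_measurable borel"
    (is "?F \<in> _")
proof -
  have "{x \<in> space borel. c \<le> ?F x} \<in> sets borel" for c
  proof (cases "c \<le> 0")
    case True
    have "0 \<le> ?F x" for x
      by (auto simp: indicator_def superlevel_def zero_ereal_def real_of_ereal_pos)
    then have "{x. c \<le> ?F x} = UNIV" using True by (auto intro: order_trans)
    then show ?thesis by simp
  next
    case False
    have "c \<le> ?F x \<longleftrightarrow> x \<in> superlevel g K c" for x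
    proof (cases "x \<in> superlevel g K 0")
      case True
      then have "ereal (real_of_ereal (legendre_fenchel g x)) = legendre_fenchel g x" "x \<in> K"
        by (auto intro!: legendre_fenchel_real simp: superlevel_def zero_ereal_def)
      with True show ?thesis by (simp add: superlevel_def) (metis ereal_less_eq(3))
    next
      case no: False
      have "superlevel g K c \<subseteq> superlevel g K 0"
        using False by (auto simp: superlevel_def intro: order_trans[of _ "ereal c"])
      then have "x \<notin> superlevel g K c" using no by blast
      then show ?thesis using no False by simp
    qed
    then have "{x. c \<le> ?F x} = superlevel g K c" by auto
    then show ?thesis using closed_superlevel[OF assms] by simp
  qed
  then show ?thesis by (subst borel_measurable_iff_ge) auto
qed

section \<open>Completeness of projective fans\<close>

lemma exponents_zero [simp]: "exponents 0 = {}"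
  by (simp add: exponents_def zero_laurent.rep_eq)

lemma finite_exponents [simp]: "finite (exponents f)"
  by (simp add: exponents_def)

lemma exponents_empty_iff [simp]: "exponents f = {} \<longleftrightarrow> f = 0"
  by (simp add: exponents_def zero_laurent.rep_eq flip: poly_of_inject)

lemma exponents_mult: "exponents (f * g) \<subseteq> {a + b | a b. a \<in> exponents f \<and> b \<in> exponents g}"
  unfolding exponents_def times_laurent.rep_eq by (rule keys_mult)

lemma exponents_add: "exponents (f + g) \<subseteq> exponents f \<union> exponents g"
  unfolding exponents_def plus_laurent.rep_eq by (rule Poly_Mapping.keys_add)

lemma real_vec_add: "real_vec (a + b) = real_vec a + real_vec b"
  by (simp add: real_vec_def vec_eq_iff)

lemma real_vec_zero [simp]: "real_vec 0 = 0"
  by (simp add: real_vec_def vec_eq_iff)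

lemma character_zero [simp]: "character 0 = 1"
  by (simp add: character_def one_laurent.abs_eq)

lemma exponents_character [simp]: "exponents (character m) = {m}"
  by (simp add: exponents_def character_def Laurent_inverse)

text \<open>The toric valuation of real weight \<open>u\<close>. At 0 the minimum runs over the
  empty set and means nothing, whence the hypotheses \<open>f \<noteq> 0\<close> below.\<close>

definition monomial_val :: "real ^ 'n \<Rightarrow> 'n::finite laurent \<Rightarrow> real" where
  "monomial_val u f = (MIN m\<in>exponents f. pairing m u)"

lemma monomial_val_le: "m \<in> exponents f \<Longrightarrow> monomial_val u f \<le> pairing m u"
  unfolding monomial_val_def by (intro Min_le) auto

lemma monomial_val_ge:
  "f \<noteq> 0 \<Longrightarrow> (\<And>m. m \<in> exponents f \<Longrightarrow> c \<le> pairing m u) \<Longrightarrow> c \<le> monomial_val u f"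
  unfolding monomial_val_def by (subst Min_ge_iff) auto

text \<open>Ties between monomials of minimal weight are broken by an embedding into an ordered group.\<close>

lemma monomial_val_mult:
  fixes f g :: "'n::finite laurent"
  assumes "f \<noteq> 0" "g \<noteq> 0"
  shows "monomial_val u (f * g) = monomial_val u f + monomial_val u g"
proof (rule antisym)
  obtain r :: "int ^ 'n \<Rightarrow> (nat \<Rightarrow>\<^sub>0 int)" where r: "inj r" "\<And>x y. r (x + y) = r x + r y"
    using exists_additive_embedding by blast
  have min: "\<exists>a\<in>exponents h. pairing a u = monomial_val u h \<and>
      (\<forall>k\<in>exponents h. pairing k u = pairing a u \<longrightarrow> r a \<le> r k)"
    if "h \<noteq> 0" for h :: "'n laurent"
  proof -
    let ?E = "{k \<in> exponents h. pairing k u = monomial_val u h}"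
    have "monomial_val u h \<in> (\<lambda>m. pairing m u) ` exponents h"
      unfolding monomial_val_def by (intro Min_in) (use that in auto)
    then have ne: "r ` ?E \<noteq> {}" by auto
    have fin: "finite (r ` ?E)" by simp
    from Min_in[OF fin ne] obtain a where "a \<in> ?E" "r a = Min (r ` ?E)" by auto
    then show ?thesis using Min_le[OF fin] by (metis (mono_tags, lifting) imageI mem_Collect_eq)
  qed
  obtain a where a: "a \<in> exponents f" "pairing a u = monomial_val u f"
      "\<And>k. k \<in> exponents f \<Longrightarrow> pairing k u = pairing a u \<Longrightarrow> r a \<le> r k"
    using min[OF assms(1)] by blast
  obtain b where b: "b \<in> exponents g" "pairing b u = monomial_val u g"
      "\<And>k. k \<in> exponents g \<Longrightarrow> pairing k u = pairing b u \<Longrightarrow> r b \<le> r k"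
    using min[OF assms(2)] by blast
  have "Poly_Mapping.lookup (poly_of f * poly_of g) (a + b) =
      Poly_Mapping.lookup (poly_of f) a * Poly_Mapping.lookup (poly_of g) b"
  proof (rule lookup_times_unique_sum)
    fix k l assume "k \<in> Poly_Mapping.keys (poly_of f)" "l \<in> Poly_Mapping.keys (poly_of g)"
      and kl: "k + l = a + b"
    then have k: "k \<in> exponents f" and l: "l \<in> exponents g" by (auto simp: exponents_def)
    have "pairing k u + pairing l u = pairing a u + pairing b u"
      using kl by (metis real_vec_add inner_add_left)
    moreover have "pairing a u \<le> pairing k u" "pairing b u \<le> pairing l u"
      using monomial_val_le[OF k, of u] monomial_val_le[OF l, of u] a(2) b(2) by auto
    ultimately have "pairing k u = pairing a u" "pairing l u = pairing b u" by linarith+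
    then have "r a \<le> r k" "r b \<le> r l" using a(3) b(3) k l by auto
    moreover have "r k + r l = r a + r b" using kl r(2) by metis
    ultimately have "r k = r a"
      by (metis add_less_le_mono order_less_irrefl order_le_less)
    then have "k = a" using r(1) by (simp add: inj_eq)
    then show "k = a \<and> l = b" using kl by simp
  qed
  moreover have "\<dots> \<noteq> 0" using a(1) b(1) by (simp add: in_keys_iff exponents_def)
  ultimately have "a + b \<in> exponents (f * g)"
    by (simp add: exponents_def times_laurent.rep_eq in_keys_iff)
  from monomial_val_le[OF this, of u]
  show "monomial_val u (f * g) \<le> monomial_val u f + monomial_val u g"
    using a(2) b(2) by (simp add: real_vec_add inner_add_left)
  show "monomial_val u f + monomial_val u g \<le> monomial_val u (f * g)"
  proof (rule monomial_val_ge)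
    show "f * g \<noteq> 0" using assms by simp
    fix m assume "m \<in> exponents (f * g)"
    then obtain k l where "m = k + l" "k \<in> exponents f" "l \<in> exponents g"
      using exponents_mult by blast
    then show "monomial_val u f + monomial_val u g \<le> pairing m u"
      using monomial_val_le[of k f u] monomial_val_le[of l g u]
      by (simp add: real_vec_add inner_add_left)
  qed
qed

lemma monomial_val_add:
  assumes "f + g \<noteq> 0"
  shows "min (monomial_val u f) (monomial_val u g) \<le> monomial_val u (f + g)"
proof (rule monomial_val_ge[OF assms])
  fix m assume "m \<in> exponents (f + g)"
  then have "m \<in> exponents f \<or> m \<in> exponents g" using exponents_add by blast
  then show "min (monomial_val u f) (monomial_val u g) \<le> pairing m u"
    by (auto simp: min_le_iff_disj monomial_val_le)
qed

text \<open>A valuation with real value group. The value at 0 ought to be infinite and is left free,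
  so all arguments are nonzero.\<close>

definition real_valuation :: "('k::field \<Rightarrow> real) \<Rightarrow> bool" where
  "real_valuation w \<longleftrightarrow>
     (\<forall>x y. x \<noteq> 0 \<longrightarrow> y \<noteq> 0 \<longrightarrow> w (x * y) = w x + w y) \<and>
     (\<forall>x y. x \<noteq> 0 \<longrightarrow> y \<noteq> 0 \<longrightarrow> x + y \<noteq> 0 \<longrightarrow> min (w x) (w y) \<le> w (x + y))"

text \<open>Multiplicativity makes \<open>?v f - ?v g\<close> independent of the fraction
  representing an element; the inequality for sums follows over a common denominator.\<close>

lemma exists_monomial_valuation:
  fixes u :: "real ^ 'n::finite"
  shows "\<exists>w :: 'n laurent fract \<Rightarrow> real.
    real_valuation w \<and> (\<forall>f. f \<noteq> 0 \<longrightarrow> w (Fract f 1) = monomial_val u f)"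
proof -
  let ?v = "monomial_val u"
  define P where "P q p \<longleftrightarrow> snd p \<noteq> 0 \<and> q = Fract (fst p) (snd p)"
    for q and p :: "'n laurent \<times> 'n laurent"
  define w where "w q = (let p = SOME p. P q p in ?v (fst p) - ?v (snd p))" for q
  have one: "?v 1 = 0"
    using monomial_val_mult[of 1 "1 :: 'n laurent" u] by simp
  have w: "w (Fract f g) = ?v f - ?v g" if "f \<noteq> 0" "g \<noteq> 0" for f g
  proof -
    define p where "p = (SOME p. P (Fract f g) p)"
    have "P (Fract f g) p" unfolding p_def by (rule someI[of _ "(f, g)"]) (use that in \<open>simp add: P_def\<close>)
    then have p: "snd p \<noteq> 0" "f * snd p = fst p * g"
      using that by (auto simp: P_def eq_fract)
    then have "fst p \<noteq> 0" using that by auto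
    then have "?v f + ?v (snd p) = ?v (fst p) + ?v g"
      using p that by (metis monomial_val_mult)
    then show ?thesis by (simp add: w_def flip: p_def)
  qed
  have rep: "\<exists>f g. f \<noteq> 0 \<and> g \<noteq> 0 \<and> q = Fract f g" if "q \<noteq> 0" for q :: "'n laurent fract"
    using that by (cases q) (metis fract_collapse(1))
  have "real_valuation w"
    unfolding real_valuation_def
  proof (intro conjI allI impI)
    fix x y :: "'n laurent fract" assume "x \<noteq> 0" "y \<noteq> 0"
    then obtain a b c d where *: "a \<noteq> 0" "b \<noteq> 0" "x = Fract a b" "c \<noteq> 0" "d \<noteq> 0" "y = Fract c d"
      using rep by metis
    then show "w (x * y) = w x + w y" by (simp add: w monomial_val_mult)
    assume "x + y \<noteq> 0"
    have xy: "x + y = Fract (a * d + c * b) (b * d)" using * by simp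
    then have n: "a * d + c * b \<noteq> 0" using \<open>x + y \<noteq> 0\<close> by (metis fract_collapse(1))
    have "min (?v a + ?v d) (?v c + ?v b) \<le> ?v (a * d + c * b)"
      using monomial_val_add[OF n, of u] * by (simp add: monomial_val_mult)
    then show "min (w x) (w y) \<le> w (x + y)"
      unfolding xy using * n by (simp add: w monomial_val_mult min_def split: if_splits)
  qed
  moreover have "w (Fract f 1) = ?v f" if "f \<noteq> 0" for f using w[OF that, of 1] one by simp
  ultimately show ?thesis by blast
qed

section \<open>Centers of real valuations on affine charts\<close>

lemma ring_of_type_algebra_simps:
  "carrier ring_of_type_algebra = UNIV" "\<zero>\<^bsub>ring_of_type_algebra\<^esub> = 0" "\<one>\<^bsub>ring_of_type_algebra\<^esub> = 1"
  "x \<oplus>\<^bsub>ring_of_type_algebra\<^esub> y = x + y" "x \<otimes>\<^bsub>ring_of_type_algebra\<^esub> y = x * y"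
  by (simp_all add: ring_of_type_algebra_def)

lemma subring_record_a_inv:
  fixes A :: "'k::comm_ring_1 set"
  assumes "ring (subring_record A)" "h \<in> A" "- h \<in> A"
  shows "\<ominus>\<^bsub>subring_record A\<^esub> h = - h"
proof -
  interpret ring "subring_record A" by fact
  show ?thesis by (rule minus_equality) (use assms in \<open>auto simp: ring_of_type_algebra_simps\<close>)
qed

lemma ring_of_type_algebra_a_inv: "\<ominus>\<^bsub>ring_of_type_algebra\<^esub> h = - (h :: 'k::comm_ring_1)"
proof -
  interpret ring "ring_of_type_algebra :: 'k ring" by (rule ring_from_type_algebra)
  show ?thesis by (rule minus_equality) (auto simp: ring_of_type_algebra_simps)
qed

context
  fixes w :: "'k::field \<Rightarrow> real"
  assumes w: "real_valuation w"
begin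

lemma valuation_mult: "x \<noteq> 0 \<Longrightarrow> y \<noteq> 0 \<Longrightarrow> w (x * y) = w x + w y"
  using w by (simp add: real_valuation_def)

lemma valuation_add: "x \<noteq> 0 \<Longrightarrow> y \<noteq> 0 \<Longrightarrow> x + y \<noteq> 0 \<Longrightarrow> min (w x) (w y) \<le> w (x + y)"
  using w by (simp add: real_valuation_def)

text \<open>The disjunct \<open>x = 0\<close> plays the role of an infinite value at 0.\<close>

lemma valuation_add_ge:
  "x = 0 \<or> c \<le> w x \<Longrightarrow> y = 0 \<or> c \<le> w y \<Longrightarrow> x + y = 0 \<or> c \<le> w (x + y)"
  using valuation_add[of x y] by fastforce

lemma valuation_add_gt:
  "x = 0 \<or> c < w x \<Longrightarrow> y = 0 \<or> c < w y \<Longrightarrow> x + y = 0 \<or> c < w (x + y)"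
  using valuation_add[of x y] by fastforce

lemma valuation_one: "w 1 = 0"
  using valuation_mult[of 1 1] by simp

lemma valuation_uminus: "w (- x) = w x"
proof (cases "x = 0")
  case False
  have "w (-1) + w (-1) = 0" using valuation_mult[of "-1" "-1"] valuation_one by simp
  then show ?thesis using valuation_mult[of "-1" x] False by simp
qed simp

lemma valuation_divide: "x \<noteq> 0 \<Longrightarrow> y \<noteq> 0 \<Longrightarrow> w (x / y) = w x - w y"
  using valuation_mult[of "x / y" y] by simp

lemma valuation_ring_generate:
  assumes "\<And>h. h \<in> H \<Longrightarrow> h = 0 \<or> 0 \<le> w h" "a \<in> generate_ring ring_of_type_algebra H"
  shows "a = 0 \<or> 0 \<le> w a"
  using assms(2)
proof induction
  case (a_inv h)
  then show ?case by (auto simp: valuation_uminus ring_of_type_algebra_a_inv)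
next
  case (eng_add x y)
  then show ?case using valuation_add_ge[of x 0 y] by (simp add: ring_of_type_algebra_simps)
next
  case (eng_mult x y)
  then show ?case
    by (cases "x = 0 \<or> y = 0") (auto simp: ring_of_type_algebra_simps valuation_mult)
qed (auto simp: ring_of_type_algebra_simps valuation_one assms(1))

text \<open>The center of the valuation: the elements of \<open>A\<close> of positive value form a
  prime ideal, and the remaining nonzero elements have value 0, so localizing there creates no
  negative values.\<close>

lemma local_ring_in_valuation_ring:
  fixes H :: "'k set"
  defines "A \<equiv> generate_ring ring_of_type_algebra H"
  assumes nonneg: "\<And>h. h \<in> H \<Longrightarrow> h = 0 \<or> 0 \<le> w h"
  shows "\<exists>L\<in>local_rings A. \<forall>a\<in>L. a = 0 \<or> 0 \<le> w a"
proof -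
  define p where "p = {a \<in> A. a = 0 \<or> 0 < w a}"
  interpret K: cring "ring_of_type_algebra :: 'k ring" by (rule cring_from_type_algebra)
  have val: "a = 0 \<or> 0 \<le> w a" if "a \<in> A" for a
    using valuation_ring_generate[OF nonneg] that unfolding A_def by blast
  have sub: "subring A ring_of_type_algebra"
    unfolding A_def by (rule K.generate_ring_is_subring) (simp add: ring_of_type_algebra_simps)
  then have cr: "cring (subring_record A)"
    using K.subcring_iff[of A] K.subcringI'[OF sub] by (simp add: ring_of_type_algebra_simps)
  interpret A: cring "subring_record A" by fact
  note simps = ring_of_type_algebra_simps
  have closed: "0 \<in> A" "1 \<in> A" "a \<in> A \<Longrightarrow> - a \<in> A" "a \<in> A \<Longrightarrow> b \<in> A \<Longrightarrow> a + b \<in> A"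
      "a \<in> A \<Longrightarrow> b \<in> A \<Longrightarrow> a * b \<in> A" for a b
    using subringE(2,3,5,6,7)[OF sub] by (auto simp: simps ring_of_type_algebra_a_inv)
  have "primeideal p (subring_record A)"
  proof (rule primeidealI2)
    show "additive_subgroup p (subring_record A)"
    proof (intro additive_subgroup.intro A.add.subgroupI)
      show "p \<subseteq> carrier (subring_record A)" by (auto simp: p_def)
      show "p \<noteq> {}" using closed(1) by (auto simp: p_def)
      fix a b assume a: "a \<in> p" and b: "b \<in> p"
      show "\<ominus>\<^bsub>subring_record A\<^esub> a \<in> p"
        using a closed by (auto simp: p_def subring_record_a_inv[OF A.ring_axioms] valuation_uminus)
      show "a \<oplus>\<^bsub>subring_record A\<^esub> b \<in> p"
        using a b closed valuation_add_gt[of a 0 b] by (simp add: p_def simps)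
    qed
    show "cring (subring_record A)" by fact
    have "1 \<notin> p" using valuation_one by (simp add: p_def)
    then show "carrier (subring_record A) \<noteq> p" using closed(2) by auto
  next
    fix a x assume ax: "a \<in> p" "x \<in> carrier (subring_record A)"
    then show "x \<otimes>\<^bsub>subring_record A\<^esub> a \<in> p" "a \<otimes>\<^bsub>subring_record A\<^esub> x \<in> p"
      using val[of x] closed
      by (cases "a = 0 \<or> x = 0"; force simp: p_def simps valuation_mult)+
  next
    fix a b assume "a \<in> carrier (subring_record A)" "b \<in> carrier (subring_record A)"
      "a \<otimes>\<^bsub>subring_record A\<^esub> b \<in> p"
    then show "a \<in> p \<or> b \<in> p"
      using val[of a] val[of b]
      by (cases "a = 0 \<or> b = 0") (auto simp: p_def simps valuation_mult)
  qed
  then have "{a / b | a b. a \<in> A \<and> b \<in> A - p} \<in> local_rings A"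
    by (auto simp: local_rings_def)
  moreover have "a / b = 0 \<or> 0 \<le> w (a / b)" if "a \<in> A" "b \<in> A - p" for a b
    using val[of a] val[of b] that by (cases "a = 0") (auto simp: p_def valuation_divide)
  then have "\<forall>x\<in>{a / b | a b. a \<in> A \<and> b \<in> A - p}. x = 0 \<or> 0 \<le> w x" by blast
  ultimately show ?thesis by (rule bexI[rotated])
qed

end

lemma subset_local_ring:
  assumes "L \<in> local_rings A" "1 \<in> A"
  shows "A \<subseteq> L"
proof -
  obtain p where p: "primeideal p (subring_record A)" "L = {a / b | a b. a \<in> A \<and> b \<in> A - p}"
    using assms(1) by (auto simp: local_rings_def)
  interpret primeideal p "subring_record A" by fact
  have "1 \<notin> p" using one_imp_carrier I_notcarr by (auto simp: ring_of_type_algebra_simps)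
  then have "a / 1 \<in> L" if "a \<in> A" for a using p(2) assms(2) that by blast
  then show ?thesis by auto
qed

text \<open>
  The valuative criterion of properness: the local ring of projective space at the center of the
  monomial valuation of weight \<open>u\<close> is a local ring of some chart.
\<close>

lemma projective_toric_center:
  fixes \<Sigma> :: "(real ^ 'n::finite) set set"
  assumes "projective_toric \<Sigma>"
  shows "\<exists>\<sigma>\<in>\<Sigma>. \<forall>m\<in>dual_monoid \<sigma>. 0 \<le> pairing m u"
proof -
  obtain N and f :: "nat \<Rightarrow> 'n laurent fract" where f: "\<And>i. i \<le> N \<Longrightarrow> f i \<noteq> 0"
    and loc: "(\<Union>\<sigma>\<in>\<Sigma>. local_rings (function_field_ring \<sigma>)) =
        (\<Union>i\<in>{..N}. local_rings (generate_ring ring_of_type_algebra {f j / f i | j. j \<le> N}))"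
    using assms unfolding projective_toric_def by blast
  obtain w :: "'n laurent fract \<Rightarrow> real"
    where w: "real_valuation w" "\<And>f. f \<noteq> 0 \<Longrightarrow> w (Fract f 1) = monomial_val u f"
    using exists_monomial_valuation[of u] by blast
  \<comment> \<open>The chart containing the center: dividing by the coordinate of least value makes
    all generators \<open>f j / f i\<close> nonnegative.\<close>
  obtain i where i: "i \<le> N" "\<And>j. j \<le> N \<Longrightarrow> w (f i) \<le> w (f j)"
    using Min_in[of "(\<lambda>i. w (f i)) ` {..N}"] Min_le[of "(\<lambda>i. w (f i)) ` {..N}"] by fastforce
  have nonneg: "h = 0 \<or> 0 \<le> w h" if h: "h \<in> {f j / f i | j. j \<le> N}" for h
  proof -
    obtain j where j: "j \<le> N" "h = f j / f i" using h by blast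
    then have "w h = w (f j) - w (f i)" using valuation_divide[OF w(1)] f i(1) by metis
    then show ?thesis using i(2)[OF j(1)] by simp
  qed
  have "\<exists>L\<in>local_rings (generate_ring ring_of_type_algebra {f j / f i | j. j \<le> N}).
      \<forall>a\<in>L. a = 0 \<or> 0 \<le> w a"
    by (rule local_ring_in_valuation_ring[OF w(1) nonneg])
  then obtain L where L: "L \<in> local_rings (generate_ring ring_of_type_algebra {f j / f i | j. j \<le> N})"
      "\<forall>a\<in>L. a = 0 \<or> 0 \<le> w a" ..
  have "L \<in> (\<Union>\<sigma>\<in>\<Sigma>. local_rings (function_field_ring \<sigma>))"
    unfolding loc using i(1) L(1) by (intro UN_I[of i]) simp_all
  then obtain \<sigma> where \<sigma>: "\<sigma> \<in> \<Sigma>" "L \<in> local_rings (function_field_ring \<sigma>)"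
    by (rule UN_E)
  \<comment> \<open>The characters in the chart ring lie in \<open>L\<close> and so have nonnegative
    value; that value is the pairing with \<open>u\<close>.\<close>
  have char: "Fract (character m) 1 \<in> function_field_ring \<sigma>" if "m \<in> dual_monoid \<sigma>" for m
    using that by (simp add: function_field_ring_def chart_ring_def)
  have "0 \<in> dual_monoid \<sigma>" by (simp add: dual_monoid_def)
  then have "1 \<in> function_field_ring \<sigma>"
    unfolding One_fract_def using char[of 0] by simp
  then have sub: "function_field_ring \<sigma> \<subseteq> L" using subset_local_ring[OF \<sigma>(2)] by blast
  show ?thesis
  proof (intro bexI[OF _ \<sigma>(1)] ballI)
    fix m assume m: "m \<in> dual_monoid \<sigma>"
    have nz: "character m \<noteq> 0" by (simp flip: exponents_empty_iff)
    have "Fract (character m) 1 \<in> L" using char[OF m] sub by blast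
    moreover have "Fract (character m) 1 \<noteq> 0" using nz by (simp add: Zero_fract_def eq_fract)
    ultimately have "0 \<le> w (Fract (character m) 1)" using L(2) by blast
    then show "0 \<le> pairing m u" using w(2)[OF nz] by (simp add: monomial_val_def)
  qed
qed

section \<open>Rational cones and the integral points of their duals\<close>

lemma convex_cone_hull_nonneg:
  assumes "\<And>v. v \<in> S \<Longrightarrow> 0 \<le> a \<bullet> v" "x \<in> convex_cone hull S"
  shows "0 \<le> a \<bullet> x"
proof -
  have "convex_cone hull S \<subseteq> {x. 0 \<le> a \<bullet> x}"
    by (rule hull_minimal) (use assms(1) convex_cone_halfspace_ge in auto)
  then show ?thesis using assms(2) by auto
qed

text \<open>If a convex combination vanishes, a summand with nonzero coefficient equals minus the
  sum of the others, so it and its negative lie in the cone; pointedness makes it zero.\<close>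

lemma zero_notin_convex_hull_generators:
  fixes G :: "'a::real_vector set"
  assumes "finite G" "0 \<notin> G" and pointed: "convex_cone hull G \<inter> uminus ` (convex_cone hull G) = {0}"
  shows "0 \<notin> convex hull G"
proof
  let ?\<sigma> = "convex_cone hull G"
  assume "0 \<in> convex hull G"
  then obtain c where c: "\<And>x. x \<in> G \<Longrightarrow> 0 \<le> c x" "sum c G = 1" "(\<Sum>x\<in>G. c x *\<^sub>R x) = 0"
    using assms(1) by (auto simp: convex_hull_finite)
  then obtain v where v: "v \<in> G" "c v \<noteq> 0" by (metis sum.neutral zero_neq_one)
  have mem: "x \<in> G \<Longrightarrow> c x *\<^sub>R x \<in> ?\<sigma>" for x
    using c(1) by (intro convex_cone_hull_mul hull_inc)
  have sum: "(\<Sum>x\<in>T. c x *\<^sub>R x) \<in> ?\<sigma>" if "T \<subseteq> G" for T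
    using finite_subset[OF that assms(1)] that
    by (induction T rule: finite_induct)
      (auto simp: convex_cone_hull_contains_0 intro!: convex_cone_hull_add mem)
  have "c v *\<^sub>R v = - (\<Sum>x\<in>G - {v}. c x *\<^sub>R x)"
    using c(3) v(1) assms(1) by (simp add: sum.remove eq_neg_iff_add_eq_0)
  then have "c v *\<^sub>R v \<in> uminus ` ?\<sigma>" using sum[of "G - {v}"] by auto
  then have "c v *\<^sub>R v = 0" using mem[OF v(1)] pointed by blast
  then show False using v assms(2) by auto
qed

text \<open>A hyperplane separating \<open>u\<close> from the cone is in general only real. If it is
  strictly positive on \<open>- u\<close> and on the finitely many generators, this survives a small
  perturbation, so it may be taken rational and then, after scaling, integral.\<close>

lemma cone_bidual:
  fixes \<sigma> :: "(real ^ 'n::finite) set"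
  assumes "strongly_convex_rational_cone \<sigma>" "\<And>m. m \<in> dual_monoid \<sigma> \<Longrightarrow> 0 \<le> pairing m u"
  shows "u \<in> \<sigma>"
proof (rule ccontr)
  assume u: "u \<notin> \<sigma>"
  obtain F where F: "finite F" "\<sigma> = convex_cone hull (real_vec ` F)"
    and pointed: "\<sigma> \<inter> uminus ` \<sigma> = {0}"
    using assms(1) by (auto simp: strongly_convex_rational_cone_def)
  \<comment> \<open>Zero generators are dropped, since no functional is strictly positive on
    them.\<close>
  define G where "G = real_vec ` F - {0}"
  have fin: "finite G" using F(1) by (simp add: G_def)
  have \<sigma>: "\<sigma> = convex_cone hull G"
  proof
    have "v \<in> convex_cone hull G" if "v \<in> real_vec ` F" for v
      using that convex_cone_hull_contains_0[of G] hull_inc[of v G convex_cone]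
      by (cases "v = 0") (simp_all add: G_def)
    then have "real_vec ` F \<subseteq> convex_cone hull G" by blast
    then show "\<sigma> \<subseteq> convex_cone hull G"
      unfolding F(2) by (intro hull_minimal convex_cone_convex_cone_hull)
    show "convex_cone hull G \<subseteq> \<sigma>"
      unfolding F(2) by (intro hull_mono) (auto simp: G_def)
  qed
  have G0: "0 \<notin> convex hull G"
    by (rule zero_notin_convex_hull_generators) (use fin pointed \<sigma> in \<open>auto simp: G_def\<close>)
  \<comment> \<open>Otherwise either 0 is a convex combination of generators, against pointedness,
    or \<open>u\<close> is a nonnegative multiple of such a combination and lies in the
    cone.\<close>
  have "0 \<notin> convex hull (insert (- u) G)"
  proof
    assume "0 \<in> convex hull (insert (- u) G)"
    moreover have "0 \<in> \<sigma>" unfolding \<sigma> by (rule convex_cone_hull_contains_0)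
    ultimately have "G \<noteq> {}" using u by auto
    then obtain s v b where b: "s \<ge> 0" "v \<ge> 0" "s + v = 1" "b \<in> convex hull G" "0 = s *\<^sub>R (- u) + v *\<^sub>R b"
      using \<open>0 \<in> convex hull (insert (- u) G)\<close> by (auto simp: convex_hull_insert)
    show False
    proof (cases "s = 0")
      case True
      then show False using b G0 by auto
    next
      case False
      have "s *\<^sub>R u = v *\<^sub>R b" using b(5) by simp
      then have "u = (v / s) *\<^sub>R b"
        using False by (metis divide_inverse_commute scaleR_scaleR scaleR_one left_inverse)
      moreover have "b \<in> \<sigma>" unfolding \<sigma> using convex_hull_subset_convex_cone_hull b(4) by blast
      ultimately show False using u b(1,2) unfolding \<sigma> by (auto intro: convex_cone_hull_mul)
    qed
  qed
  moreover have "closed (convex hull (insert (- u) G))"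
    using fin by (intro compact_imp_closed finite_imp_compact_convex_hull) auto
  ultimately obtain a b where ab: "0 < b" "\<And>x. x \<in> convex hull (insert (- u) G) \<Longrightarrow> b < a \<bullet> x"
    using separating_hyperplane_closed_0[of "convex hull (insert (- u) G)"] convex_convex_hull by metis
  then have pos: "0 < a \<bullet> x" if "x \<in> insert (- u) G" for x
    using that hull_inc[of x "insert (- u) G" convex] by fastforce
  let ?m = "\<lambda>l. \<chi> i. \<lfloor>real l * a $ i\<rfloor>"
  have "\<forall>\<^sub>F l in sequentially. \<forall>x\<in>insert (- u) G. 0 < (real_vec (?m l) /\<^sub>R real l) \<bullet> x"
  proof (rule eventually_ball_finite)
    show "finite (insert (- u) G)" using fin by simp
    show "\<forall>x\<in>insert (- u) G. \<forall>\<^sub>F l in sequentially. 0 < (real_vec (?m l) /\<^sub>R real l) \<bullet> x"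
    proof
      fix x assume "x \<in> insert (- u) G"
      have "(\<lambda>l. (real_vec (?m l) /\<^sub>R real l) \<bullet> x) \<longlonglongrightarrow> a \<bullet> x"
        by (intro tendsto_inner floor_vec_tendsto tendsto_const)
      then show "\<forall>\<^sub>F l in sequentially. 0 < (real_vec (?m l) /\<^sub>R real l) \<bullet> x"
        by (rule order_tendstoD) (rule pos, fact)
    qed
  qed
  then obtain l where l: "\<And>x. x \<in> insert (- u) G \<Longrightarrow> 0 < (real_vec (?m l) /\<^sub>R real l) \<bullet> x"
    using eventually_happens by force
  have pos': "0 < pairing (?m l) x" if "x \<in> insert (- u) G" for x
    using l[OF that] by (auto simp: zero_less_mult_iff)
  have "?m l \<in> dual_monoid \<sigma>"
    unfolding dual_monoid_def \<sigma>
    using convex_cone_hull_nonneg[of G "real_vec (?m l)"] less_imp_le[OF pos'] by blast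
  from assms(2)[OF this] pos'[of "- u"] show False by simp
qed

lemma projective_toric_complete:
  fixes \<Sigma> :: "(real ^ 'n::finite) set set"
  assumes "is_fan \<Sigma>" "projective_toric \<Sigma>"
  shows "\<exists>\<sigma>\<in>\<Sigma>. u \<in> \<sigma>"
proof -
  obtain \<sigma> where "\<sigma> \<in> \<Sigma>" "\<forall>m\<in>dual_monoid \<sigma>. 0 \<le> pairing m u"
    using projective_toric_center[OF assms(2)] by (rule bexE)
  moreover from this have "u \<in> \<sigma>"
    using assms(1) by (intro cone_bidual) (auto simp: is_fan_def)
  ultimately show ?thesis by (intro bexI)
qed

text \<open>Strong convexity makes the origin a face. Its chart is the torus, where
  \<open>g_metric\<close> and the coefficient bounds live.\<close>

lemma zero_cone_in_fan:
  assumes "is_fan \<Sigma>"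
  shows "{0} \<in> \<Sigma>"
proof -
  obtain \<sigma> where \<sigma>: "\<sigma> \<in> \<Sigma>" using assms by (auto simp: is_fan_def)
  then have \<sigma>': "strongly_convex_rational_cone \<sigma>" using assms by (auto simp: is_fan_def)
  then obtain F where F: "\<sigma> = convex_cone hull (real_vec ` F)" and pointed: "\<sigma> \<inter> uminus ` \<sigma> = {0}"
    by (auto simp: strongly_convex_rational_cone_def)
  have "{0} face_of \<sigma>"
    unfolding face_of_def
  proof (intro conjI ballI impI)
    show "{0} \<subseteq> \<sigma>" unfolding F by (simp add: convex_cone_hull_contains_0)
    fix a b x assume ab: "a \<in> \<sigma>" "b \<in> \<sigma>" "x \<in> {0}" "x \<in> open_segment a b"
    then obtain t where t: "0 < t" "t < 1" "(1 - t) *\<^sub>R a + t *\<^sub>R b = 0" "a \<noteq> b"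
      by (auto simp: in_segment)
    have mem: "(1 - t) *\<^sub>R a \<in> \<sigma>" "t *\<^sub>R b \<in> \<sigma>"
      using ab t unfolding F by (auto intro!: convex_cone_hull_mul)
    have "(1 - t) *\<^sub>R a = - (t *\<^sub>R b)" using t(3) by (simp add: eq_neg_iff_add_eq_0)
    then have "(1 - t) *\<^sub>R a = 0" using mem pointed by blast
    then show "a \<in> {0}" "b \<in> {0}" using t by auto
  qed simp
  then show ?thesis using assms \<sigma> by (auto simp: is_fan_def)
qed

section \<open>Density of the torus in the charts\<close>

text \<open>A homomorphism from the subgroup \<open>H\<close> of the lattice to the nonzero complex
  numbers; \<open>y\<close> is arbitrary outside \<open>H\<close>. For \<open>H = UNIV\<close> these
  are the complex points of the torus.\<close>

definition partial_character :: "(int ^ 'n) set \<Rightarrow> (int ^ 'n \<Rightarrow> complex) \<Rightarrow> bool" where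
  "partial_character H y \<longleftrightarrow> 0 \<in> H \<and> (\<forall>a\<in>H. \<forall>b\<in>H. a + b \<in> H \<and> y (a + b) = y a * y b) \<and>
     (\<forall>a\<in>H. - a \<in> H) \<and> (\<forall>a\<in>H. y a \<noteq> 0)"

lemma partial_characterD:
  assumes "partial_character H y"
  shows "0 \<in> H" "a \<in> H \<Longrightarrow> b \<in> H \<Longrightarrow> a + b \<in> H" "a \<in> H \<Longrightarrow> - a \<in> H"
    "a \<in> H \<Longrightarrow> b \<in> H \<Longrightarrow> y (a + b) = y a * y b" "a \<in> H \<Longrightarrow> y a \<noteq> 0"
    "y 0 = 1" "a \<in> H \<Longrightarrow> y (- a) = inverse (y a)"
    "a \<in> H \<Longrightarrow> b \<in> H \<Longrightarrow> a - b \<in> H" "a \<in> H \<Longrightarrow> b \<in> H \<Longrightarrow> y (a - b) = y a / y b"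
proof -
  show *: "0 \<in> H" "a \<in> H \<Longrightarrow> b \<in> H \<Longrightarrow> a + b \<in> H" "a \<in> H \<Longrightarrow> - a \<in> H"
    "a \<in> H \<Longrightarrow> b \<in> H \<Longrightarrow> y (a + b) = y a * y b" "a \<in> H \<Longrightarrow> y a \<noteq> 0" for a b
    using assms by (auto simp: partial_character_def)
  show y0: "y 0 = 1" using *(4)[of 0 0] *(1,5) by simp
  show inv: "a \<in> H \<Longrightarrow> y (- a) = inverse (y a)" for a
    using *(4)[of "- a" a] *(3)[of a] y0 by (metis ab_left_minus inverse_unique mult.commute)
  show "a \<in> H \<Longrightarrow> b \<in> H \<Longrightarrow> a - b \<in> H"
    using *(2)[of a "- b"] *(3)[of b] by simp
  show "a \<in> H \<Longrightarrow> b \<in> H \<Longrightarrow> y (a - b) = y a / y b"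
    using *(4)[of a "- b"] *(3)[of b] inv by (simp add: divide_inverse)
qed

lemma partial_character_scale:
  assumes "partial_character H y" "a \<in> H"
  shows "k *s a \<in> H" "y (k *s a) = y a powi k"
proof -
  note D = partial_characterD[OF assms(1)]
  have nat: "int n *s a \<in> H \<and> y (int n *s a) = y a ^ n" for n
    by (induction n) (use D assms(2) in \<open>auto simp: vector_sadd_rdistrib\<close>)
  have "k *s a \<in> H \<and> y (k *s a) = y a powi k"
  proof (cases k rule: int_cases2)
    case (nonneg n)
    then show ?thesis using nat[of n] by simp
  next
    case (nonpos n)
    then have "k *s a = - (int n *s a)" by (simp add: vector_smult_lneg)
    then show ?thesis using nat[of n] D(3,7) nonpos by (simp add: power_int_minus)
  qed
  then show "k *s a \<in> H" "y (k *s a) = y a powi k" by auto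
qed

text \<open>The multiplicative group of the complex numbers is divisible.\<close>

lemma partial_character_root:
  assumes "partial_character H y"
  shows "\<exists>w. w \<noteq> 0 \<and> (\<forall>k. k *s e \<in> H \<longrightarrow> y (k *s e) = w powi k)"
proof (cases "\<exists>k>0. int k *s e \<in> H")
  case False
  have "k = 0" if "k *s e \<in> H" for k
  proof (rule ccontr)
    assume "k \<noteq> 0"
    have "\<bar>k\<bar> *s e \<in> H"
      using that partial_characterD(3)[OF assms that] by (auto simp: abs_if vector_smult_lneg)
    then have "int (nat \<bar>k\<bar>) *s e \<in> H" by simp
    then show False using False \<open>k \<noteq> 0\<close> by (metis zero_less_abs_iff zero_less_nat_eq)
  qed
  then show ?thesis
    using partial_characterD(6)[OF assms] by (intro exI[of _ 1]) force
next
  case True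
  \<comment> \<open>By division with remainder, every k with \<open>k *s e \<in> H\<close> is a
    multiple of \<open>d\<close>, so any d-th root of the value at \<open>int d *s e\<close> will
    do.\<close>
  define d where "d = (LEAST k. 0 < k \<and> int k *s e \<in> H)"
  have d: "0 < d" "int d *s e \<in> H" using LeastI_ex[OF True] by (auto simp: d_def)
  have least: "d \<le> k" if "0 < k" "int k *s e \<in> H" for k
    unfolding d_def using that by (intro Least_le) auto
  define w where "w = exp (Ln (y (int d *s e)) / of_nat d)"
  have wd: "w ^ d = y (int d *s e)"
    using d partial_characterD(5)[OF assms d(2)]
    by (simp add: w_def flip: exp_of_nat_mult)
  have "y (k *s e) = w powi k" if k: "k *s e \<in> H" for k
  proof -
    have split: "k mod int d = k - k div int d * int d" by (simp add: minus_div_mult_eq_mod)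
    have q: "(k div int d * int d) *s e = (k div int d) *s (int d *s e)"
      by (simp add: vector_smult_assoc)
    have "(k mod int d) *s e = k *s e - (k div int d) *s (int d *s e)"
      unfolding q[symmetric] split by (rule vector_sub_rdistrib)
    then have "(k mod int d) *s e \<in> H"
      using partial_characterD(8)[OF assms k partial_character_scale(1)[OF assms d(2)]] by simp
    then have mem: "int (nat (k mod int d)) *s e \<in> H" using d(1) by simp
    have "nat (k mod int d) < d" using d(1) by (simp add: nat_less_iff)
    with least[OF _ mem] have "nat (k mod int d) = 0" by (meson neq0_conv not_le)
    moreover have "0 \<le> k mod int d" using d(1) by simp
    ultimately have "k mod int d = 0" by simp
    then have k': "k = int d * (k div int d)" by (metis add.right_neutral mult_div_mod_eq)
    have "y (k *s e) = (w ^ d) powi (k div int d)"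
      by (subst k') (simp only: mult.commute[of "int d"] q partial_character_scale(2)[OF assms d(2)] wd)
    also have "\<dots> = w powi k" by (subst (2) k') (rule power_int_power)
    finally show ?thesis .
  qed
  then show ?thesis by (intro exI[of _ w]) (auto simp: w_def)
qed

text \<open>On H + Z e the element h + k e is sent to y(h) w^k. Two such expressions of one element
  differ by a multiple of e in H, where w was chosen to agree with y.\<close>

lemma partial_character_extend_one:
  fixes H :: "(int ^ 'n) set"
  assumes "partial_character H y"
  shows "\<exists>H' y'. partial_character H' y' \<and> H \<subseteq> H' \<and> e \<in> H' \<and> (\<forall>a\<in>H. y' a = y a)"
proof -
  note D = partial_characterD[OF assms]
  obtain w where w: "w \<noteq> 0" "\<And>k. k *s e \<in> H \<Longrightarrow> y (k *s e) = w powi k"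
    using partial_character_root[OF assms] by blast
  define H' where "H' = {a. \<exists>k. a - k *s e \<in> H}"
  define y' where "y' a = (let k = SOME k. a - k *s e \<in> H in y (a - k *s e) * w powi k)" for a
  have y': "y' a = y (a - k *s e) * w powi k" if k: "a - k *s e \<in> H" for a k
  proof -
    define j where "j = (SOME k. a - k *s e \<in> H)"
    have j: "a - j *s e \<in> H" unfolding j_def using k by (rule someI)
    have eq: "(k - j) *s e = (a - j *s e) - (a - k *s e)" by (simp add: vector_sub_rdistrib)
    then have "(k - j) *s e \<in> H" using D(8)[OF j k] by simp
    then have "y (a - j *s e) / y (a - k *s e) = w powi (k - j)"
      using w(2) eq D(9)[OF j k] by metis
    then show ?thesis
      using D(5)[OF k] w(1) by (simp add: y'_def Let_def power_int_diff field_simps flip: j_def)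
  qed
  have "partial_character H' y'"
    unfolding partial_character_def
  proof (intro conjI ballI)
    show "0 \<in> H'" unfolding H'_def using D(1) by (auto intro!: exI[of _ 0])
    fix a assume "a \<in> H'"
    then obtain k where k: "a - k *s e \<in> H" by (auto simp: H'_def)
    have "- a - (- k) *s e = - (a - k *s e)" by (simp add: vector_smult_lneg)
    then have "- a - (- k) *s e \<in> H" using D(3)[OF k] by (simp only:)
    then show "- a \<in> H'" unfolding H'_def by blast
    show "y' a \<noteq> 0" using y'[OF k] D(5)[OF k] w(1) by simp
    fix b assume "b \<in> H'"
    then obtain j where j: "b - j *s e \<in> H" by (auto simp: H'_def)
    have eq: "(a + b) - (k + j) *s e = (a - k *s e) + (b - j *s e)"
      by (simp add: vector_sadd_rdistrib)
    have ab: "(a + b) - (k + j) *s e \<in> H" unfolding eq by (rule D(2)[OF k j])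
    then show "a + b \<in> H'" unfolding H'_def by blast
    show "y' (a + b) = y' a * y' b"
      unfolding y'[OF ab] y'[OF k] y'[OF j] eq D(4)[OF k j] using w(1)
      by (simp add: power_int_add)
  qed
  moreover have "H \<subseteq> H'" unfolding H'_def by (auto intro!: exI[of _ 0])
  moreover have "e \<in> H'" unfolding H'_def using D(1) by (auto intro!: exI[of _ 1])
  moreover have "y' a = y a" if "a \<in> H" for a using y'[of a 0] that by simp
  ultimately show ?thesis by blast
qed

text \<open>The lattice has finite rank: adjoining the basis vectors one at a time exhausts
  it.\<close>

lemma partial_character_extend:
  fixes H :: "(int ^ 'n::finite) set"
  assumes "partial_character H y"
  shows "\<exists>y'. partial_character UNIV y' \<and> (\<forall>a\<in>H. y' a = y a)"
proof -
  have "\<exists>H' y'. partial_character H' y' \<and> H \<subseteq> H' \<and> (\<forall>i\<in>A. axis i 1 \<in> H') \<and> (\<forall>a\<in>H. y' a = y a)"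
    if "finite A" for A :: "'n set"
    using that
  proof induction
    case empty
    then show ?case using assms by blast
  next
    case (insert i A)
    then obtain H1 y1 where 1: "partial_character H1 y1" "H \<subseteq> H1" "\<forall>i\<in>A. axis i 1 \<in> H1" "\<forall>a\<in>H. y1 a = y a"
      by blast
    obtain H2 y2 where 2: "partial_character H2 y2" "H1 \<subseteq> H2" "axis i 1 \<in> H2" "\<forall>a\<in>H1. y2 a = y1 a"
      using partial_character_extend_one[OF 1(1)] by blast
    show ?case
      by (rule exI[of _ H2], rule exI[of _ y2]) (use 1 2 in auto)
  qed
  from this[of UNIV] obtain H' y' where H': "partial_character H' y'" "\<And>i. axis i 1 \<in> H'"
      "\<forall>a\<in>H. y' a = y a"
    by auto
  have "m \<in> H'" for m
  proof -
    have "(\<Sum>i\<in>A. (m $ i) *s axis i 1) \<in> H'" if "finite A" for A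
      using that
      by induction
        (auto intro!: partial_characterD(1,2)[OF H'(1)] partial_character_scale(1)[OF H'(1)] H'(2))
    from this[of UNIV] show ?thesis using basis_expansion[of m] by simp
  qed
  then have "H' = UNIV" by auto
  then show ?thesis using H' by blast
qed

text \<open>Nonvanishing on \<open>S\<close> lets \<open>x\<close> pass to the group of differences,
  with quotients as values; from that subgroup it extends to the lattice.\<close>

lemma monoid_character_extend:
  fixes S :: "(int ^ 'n::finite) set"
  assumes "0 \<in> S" "\<And>a b. a \<in> S \<Longrightarrow> b \<in> S \<Longrightarrow> a + b \<in> S"
    and "\<And>a b. a \<in> S \<Longrightarrow> b \<in> S \<Longrightarrow> x (a + b) = x a * x b" "\<And>a. a \<in> S \<Longrightarrow> x a \<noteq> 0"
  shows "\<exists>y. partial_character UNIV y \<and> (\<forall>a\<in>S. y a = x a)"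
proof -
  define H where "H = {a - b | a b. a \<in> S \<and> b \<in> S}"
  define y where "y c = (let p = SOME p. fst p \<in> S \<and> snd p \<in> S \<and> c = fst p - snd p in x (fst p) / x (snd p))" for c
  have y: "y (a - b) = x a / x b" if "a \<in> S" "b \<in> S" for a b
  proof -
    define p where "p = (SOME p. fst p \<in> S \<and> snd p \<in> S \<and> a - b = fst p - snd p)"
    have p: "fst p \<in> S \<and> snd p \<in> S \<and> a - b = fst p - snd p"
      unfolding p_def by (rule someI[of _ "(a, b)"]) (use that in auto)
    then have "a + snd p = fst p + b" by (simp add: algebra_simps)
    then have "x a * x (snd p) = x (fst p) * x b" using assms(3) p that by metis
    moreover have "x b \<noteq> 0" "x (snd p) \<noteq> 0" using p assms(4) that by auto
    ultimately have "x (fst p) / x (snd p) = x a / x b" by (simp add: frac_eq_eq)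
    then show ?thesis by (simp only: y_def Let_def p_def)
  qed
  have H: "a - b \<in> H" if "a \<in> S" "b \<in> S" for a b using that by (auto simp: H_def)
  have "partial_character H y"
    unfolding partial_character_def
  proof (intro conjI ballI)
    show "0 \<in> H" using H[OF assms(1,1)] by simp
    fix c assume "c \<in> H"
    then obtain a b where c: "c = a - b" "a \<in> S" "b \<in> S" by (auto simp: H_def)
    show "- c \<in> H" using c H[of b a] by simp
    show "y c \<noteq> 0" using c(1) y[OF c(2,3)] assms(4)[OF c(2)] assms(4)[OF c(3)] by simp
    fix c' assume "c' \<in> H"
    then obtain a' b' where c': "c' = a' - b'" "a' \<in> S" "b' \<in> S" by (auto simp: H_def)
    have eq: "c + c' = (a + a') - (b + b')" using c c' by simp
    show "c + c' \<in> H" unfolding eq using c c' by (intro H assms(2))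
    show "y (c + c') = y c * y c'" 
      unfolding eq y[OF assms(2)[OF c(2) c'(2)] assms(2)[OF c(3) c'(3)]]
      using y[OF c(2,3)] y[OF c'(2,3)] assms(3)[OF c(2) c'(2)] assms(3)[OF c(3) c'(3)]
      by (simp add: c(1) c'(1))
  qed
  then obtain y' where y': "partial_character UNIV y'" "\<And>a. a \<in> H \<Longrightarrow> y' a = y a"
    using partial_character_extend by blast
  have "x 0 = 1" using assms(3)[of 0 0] assms(4)[of 0] assms(1) by simp
  then have "y' a = x a" if "a \<in> S" for a
    using y[OF that assms(1)] y'(2)[of a] H[OF that assms(1)] by simp
  then show ?thesis using y'(1) by blast
qed

section \<open>Torus points converging to a given point of a chart\<close>

lemma real_vec_scale: "real_vec (k *s m) = of_int k *\<^sub>R real_vec m"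
  by (simp add: real_vec_def vec_eq_iff)

lemma real_vec_minus: "real_vec (a - b) = real_vec a - real_vec b"
  by (simp add: real_vec_def vec_eq_iff)

lemma real_vec_sum: "real_vec (\<Sum>i\<in>A. f i) = (\<Sum>i\<in>A. real_vec (f i))"
  by (induction A rule: infinite_finite_induct) (auto simp: real_vec_add)

lemma dual_monoid_hull:
  "m \<in> dual_monoid (convex_cone hull (real_vec ` F)) \<longleftrightarrow> (\<forall>v\<in>F. 0 \<le> pairing m (real_vec v))"
proof
  assume "m \<in> dual_monoid (convex_cone hull (real_vec ` F))"
  then show "\<forall>v\<in>F. 0 \<le> pairing m (real_vec v)"
    by (auto simp: dual_monoid_def hull_inc)
next
  assume "\<forall>v\<in>F. 0 \<le> pairing m (real_vec v)"
  then show "m \<in> dual_monoid (convex_cone hull (real_vec ` F))"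
    using convex_cone_hull_nonneg[of "real_vec ` F" "real_vec m"] by (auto simp: dual_monoid_def)
qed

lemma dual_monoid_zero: "0 \<in> dual_monoid \<sigma>"
  by (simp add: dual_monoid_def)

lemma dual_monoid_add: "a \<in> dual_monoid \<sigma> \<Longrightarrow> b \<in> dual_monoid \<sigma> \<Longrightarrow> a + b \<in> dual_monoid \<sigma>"
  by (auto simp: dual_monoid_def real_vec_add inner_add_left)

lemma chart_pointsD:
  assumes "x \<in> chart_points \<sigma>"
  shows "x 0 = 1" "m \<in> dual_monoid \<sigma> \<Longrightarrow> m' \<in> dual_monoid \<sigma> \<Longrightarrow> x (m + m') = x m * x m'"
    "m \<notin> dual_monoid \<sigma> \<Longrightarrow> x m = 0"
  using assms by (auto simp: chart_points_def)

lemma torus_exp_neg_character: "partial_character UNIV (torus_exp_neg u)"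
  by (auto simp: partial_character_def torus_exp_neg_def real_vec_add inner_add_left exp_minus exp_add)

lemma cmod_torus_exp_neg: "cmod (torus_exp_neg u m) = exp (- pairing m u)"
  by (simp add: torus_exp_neg_def)

lemma partial_character_mult:
  "partial_character H y \<Longrightarrow> partial_character H z \<Longrightarrow> partial_character H (\<lambda>m. y m * z m)"
  by (auto simp: partial_character_def)

text \<open>
  The monomials that do not vanish at \<open>x\<close> form a face of the dual monoid. On this face \<open>x\<close> extends to
  a point \<open>y\<close> of the torus, and moving \<open>y\<close> along a one-parameter subgroup in the relative interior
  of the orthogonal face of \<open>\<sigma>\<close> kills the other monomials in the limit.
\<close>

lemma torus_dense_in_chart:
  fixes \<sigma> :: "(real ^ 'n::finite) set"
  assumes \<sigma>: "strongly_convex_rational_cone \<sigma>" and x: "x \<in> chart_points \<sigma>"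
  shows "\<exists>Z. (\<forall>k. partial_character UNIV (Z k)) \<and> (\<forall>m\<in>dual_monoid \<sigma>. (\<lambda>k. Z k m) \<longlonglongrightarrow> x m)"
proof -
  obtain F where F: "finite F" and hull: "\<sigma> = convex_cone hull (real_vec ` F)"
    using \<sigma> by (auto simp: strongly_convex_rational_cone_def)
  let ?S = "dual_monoid \<sigma>"
  have S: "m \<in> ?S \<longleftrightarrow> (\<forall>v\<in>F. 0 \<le> pairing m (real_vec v))" for m
    unfolding hull by (rule dual_monoid_hull)
  note xD = chart_pointsD[OF x]
  define T where "T = {m \<in> ?S. x m \<noteq> 0}"
  have T0: "0 \<in> T" using xD(1) dual_monoid_zero by (auto simp: T_def)
  have T_add: "a + b \<in> T" if "a \<in> T" "b \<in> T" for a b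
    using that xD(2) dual_monoid_add by (auto simp: T_def)
  have T_sum: "(\<Sum>i\<in>A. f i) \<in> T" if "\<And>i. i \<in> A \<Longrightarrow> f i \<in> T" for A and f :: "int ^ 'n \<Rightarrow> int ^ 'n"
    using that by (induction A rule: infinite_finite_induct) (auto simp: T0 T_add)
  have T_scale: "int k *s a \<in> T" if "a \<in> T" for k a
    by (induction k) (use that T0 T_add in \<open>auto simp: vector_sadd_rdistrib\<close>)
  \<comment> \<open>The generators of the face of \<sigma> orthogonal to \<open>T\<close>; their sum
    \<open>u\<close> lies in its relative interior.\<close>
  define F0 where "F0 = {v \<in> F. \<forall>m\<in>T. pairing m (real_vec v) = 0}"
  define u where "u = (\<Sum>v\<in>F0. real_vec v :: real ^ 'n)"
  have u: "pairing m u = (\<Sum>v\<in>F0. pairing m (real_vec v))" for m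
    by (simp add: u_def inner_sum_right)
  have "\<exists>m\<in>T. 0 < pairing m (real_vec v)" if v: "v \<in> F - F0" for v
  proof -
    obtain m where m: "m \<in> T" "pairing m (real_vec v) \<noteq> 0" using v by (auto simp: F0_def)
    moreover have "0 \<le> pairing m (real_vec v)" using m(1) v S by (auto simp: T_def)
    ultimately show ?thesis by (intro bexI[of _ m]) auto
  qed
  then obtain n where n: "\<And>v. v \<in> F - F0 \<Longrightarrow> n v \<in> T" "\<And>v. v \<in> F - F0 \<Longrightarrow> 0 < pairing (n v) (real_vec v)"
    by metis
  \<comment> \<open>A single element of \<open>T\<close> that is positive on all generators outside
    \<open>F0\<close>.\<close>
  define m0 where "m0 = (\<Sum>v\<in>F - F0. n v)"
  have m0T: "m0 \<in> T" unfolding m0_def by (rule T_sum) (rule n)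
  have m0_pos: "0 < pairing m0 (real_vec v)" if v: "v \<in> F - F0" for v
  proof -
    have "pairing m0 (real_vec v) = (\<Sum>w\<in>F - F0. pairing (n w) (real_vec v))"
      by (simp add: m0_def real_vec_sum inner_sum_left)
    also have "\<dots> > 0"
      by (rule sum_pos2[OF _ v]) (use F n v S in \<open>auto simp: T_def\<close>)
    finally show ?thesis .
  qed
  have u_T: "pairing m u = 0" if "m \<in> T" for m
    unfolding u using that by (intro sum.neutral) (auto simp: F0_def)
  have u_pos: "0 < pairing m u" if m: "m \<in> ?S" "m \<notin> T" for m
  proof -
    have nonneg: "0 \<le> pairing m (real_vec v)" if "v \<in> F" for v using m(1) S that by auto
    have "pairing m u \<noteq> 0"
    proof
      assume "pairing m u = 0"
      then have zero: "pairing m (real_vec v) = 0" if "v \<in> F0" for v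
        unfolding u using that F nonneg
        by (subst (asm) sum_nonneg_eq_0_iff) (auto simp: F0_def)
      \<comment> \<open>If \<open>m\<close> vanishes on \<open>F0\<close>, then k m0 - m lies in the
        dual monoid for large k, because m0 outweighs m on the other generators. Then x(m) is a
        factor of x(k m0), which is nonzero, and m would belong to \<open>T\<close>.\<close>
      have "\<forall>\<^sub>F k in sequentially. \<forall>v\<in>F. 0 \<le> pairing (int k *s m0 - m) (real_vec v)"
      proof (rule eventually_ball_finite[OF F], rule ballI)
        fix v assume v: "v \<in> F"
        show "\<forall>\<^sub>F k in sequentially. 0 \<le> pairing (int k *s m0 - m) (real_vec v)"
        proof (cases "v \<in> F0")
          case True
          then show ?thesis
            using zero[OF True] m0T
            by (auto simp: real_vec_minus real_vec_scale inner_diff_left F0_def)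
        next
          case False
          then have pos: "0 < pairing m0 (real_vec v)" using m0_pos v by blast
          show ?thesis
            using eventually_ge_at_top[of "nat \<lceil>pairing m (real_vec v) / pairing m0 (real_vec v)\<rceil>"]
          proof eventually_elim
            case (elim k)
            then have "pairing m (real_vec v) / pairing m0 (real_vec v) \<le> real k" by linarith
            then have "pairing m (real_vec v) \<le> real k * pairing m0 (real_vec v)"
              using pos by (simp add: pos_divide_le_eq)
            then show ?case by (simp add: real_vec_minus real_vec_scale inner_diff_left)
          qed
        qed
      qed
      then obtain k where "\<forall>v\<in>F. 0 \<le> pairing (int k *s m0 - m) (real_vec v)"
        using eventually_happens by force
      then have k: "int k *s m0 - m \<in> ?S" by (simp add: S)
      have "x (int k *s m0 - m) * x m = x (int k *s m0)"
        using xD(2)[OF k m(1)] by simp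
      then have "x m \<noteq> 0" using T_scale[OF m0T, of k] by (auto simp: T_def)
      then show False using m by (simp add: T_def)
    qed
    moreover have "0 \<le> pairing m u"
      unfolding u using nonneg by (intro sum_nonneg) (auto simp: F0_def)
    ultimately show ?thesis by simp
  qed
  have "\<exists>y. partial_character UNIV y \<and> (\<forall>m\<in>T. y m = x m)"
  proof (rule monoid_character_extend[OF T0 T_add])
    show "x (a + b) = x a * x b" if "a \<in> T" "b \<in> T" for a b using that xD(2) by (simp add: T_def)
    show "x a \<noteq> 0" if "a \<in> T" for a using that by (simp add: T_def)
  qed
  then obtain y where y: "partial_character UNIV y" "\<And>m. m \<in> T \<Longrightarrow> y m = x m" by blast
  define Z where "Z k m = y m * torus_exp_neg (real k *\<^sub>R u) m" for k :: nat and m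
  have "partial_character UNIV (Z k)" for k
    unfolding Z_def by (intro partial_character_mult y(1) torus_exp_neg_character)
  moreover have "(\<lambda>k. Z k m) \<longlonglongrightarrow> x m" if m: "m \<in> ?S" for m
  proof (cases "m \<in> T")
    case True
    then show ?thesis using u_T y(2) by (simp add: Z_def torus_exp_neg_def)
  next
    case False
    then have xm: "x m = 0" using m by (simp add: T_def)
    have "norm (exp (- complex_of_real (pairing m u))) < 1" using u_pos[OF m False] by (simp flip: of_real_minus exp_of_real)
    then have "(\<lambda>k. y m * exp (- complex_of_real (pairing m u)) ^ k) \<longlonglongrightarrow> y m * 0"
      by (intro tendsto_mult tendsto_const LIMSEQ_power_zero)
    moreover have "Z k m = y m * exp (- complex_of_real (pairing m u)) ^ k" for k
      by (simp add: Z_def torus_exp_neg_def flip: exp_of_nat_mult)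
    ultimately show ?thesis using xm by simp
  qed
  ultimately show ?thesis by blast
qed

lemma partial_character_sum:
  assumes "partial_character UNIV z"
  shows "z (\<Sum>i\<in>A. f i) = (\<Prod>i\<in>A. z (f i))"
  by (induction A rule: infinite_finite_induct)
    (use partial_characterD[OF assms] in auto)

text \<open>The tropicalization of a torus point: minus the logarithms of its moduli at the basis
  vectors, the sign being that of \<open>torus_exp_neg\<close>.\<close>

lemma partial_character_cmod:
  fixes z :: "int ^ 'n::finite \<Rightarrow> complex"
  assumes z: "partial_character UNIV z"
  shows "\<exists>u. \<forall>m. cmod (z m) = exp (- pairing m u)"
proof (intro exI allI)
  fix m
  let ?c = "\<lambda>i. cmod (z (axis i 1))"
  let ?u = "\<chi> i. - ln (?c i)"
  have pos: "0 < ?c i" for i using partial_characterD(5)[OF z] by simp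
  have "z m = (\<Prod>i\<in>UNIV. z (axis i 1) powi (m $ i))"
    using partial_character_sum[OF z, of "\<lambda>i. (m $ i) *s axis i 1" UNIV] basis_expansion[of m]
      partial_character_scale(2)[OF z] by simp
  then have "cmod (z m) = (\<Prod>i\<in>UNIV. ?c i powi (m $ i))"
    by (simp add: norm_power_int flip: prod_norm)
  also have "\<dots> = (\<Prod>i\<in>UNIV. exp (of_int (m $ i) * ln (?c i)))"
    using pos by (intro prod.cong refl) (simp flip: exp_power_int)
  also have "\<dots> = exp (- pairing m ?u)"
    by (simp add: exp_sum[symmetric] inner_vec_def sum_negf)
  finally show "cmod (z m) = exp (- pairing m ?u)" .
qed

lemma compact_torus_character:
  assumes "t \<in> compact_torus"
  shows "partial_character UNIV t"
proof -
  have "t m \<noteq> 0" for m using assms by (auto simp: compact_torus_def) (metis norm_zero zero_neq_one)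
  then show ?thesis using assms by (auto simp: compact_torus_def partial_character_def)
qed

lemma partial_character_divide:
  "partial_character H y \<Longrightarrow> partial_character H z \<Longrightarrow> partial_character H (\<lambda>m. y m / z m)"
  by (auto simp: partial_character_def)

section \<open>Laurent polynomials on the compact torus\<close>

text \<open>The image of a torus point in the chart of \<sigma>, with the extension by 0 that
  \<open>chart_points\<close> prescribes.\<close>

definition chart_restrict :: "(real ^ 'n) set \<Rightarrow> (int ^ 'n \<Rightarrow> complex) \<Rightarrow> int ^ 'n \<Rightarrow> complex" where
  "chart_restrict \<sigma> z m = (if m \<in> dual_monoid \<sigma> then z m else 0)"

lemma chart_restrict_in_chart:
  assumes "partial_character UNIV z"
  shows "chart_restrict \<sigma> z \<in> chart_points \<sigma>"
  using partial_characterD[OF assms]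
  by (auto simp: chart_points_def chart_restrict_def dual_monoid_zero dual_monoid_add)

lemma dual_monoid_zero_cone [simp]: "dual_monoid {0} = UNIV"
  by (simp add: dual_monoid_def)

lemma character_in_torus_chart: "partial_character UNIV z \<Longrightarrow> z \<in> chart_points {0}"
  using chart_restrict_in_chart[of z "{0}"] by (simp add: chart_restrict_def[abs_def])

text \<open>As \<open>{0} \<inter> \<sigma> = {0}\<close>, the overlap is the torus and the overlap
  point is \<open>z\<close> itself.\<close>

lemma glued_via_torus:
  assumes "partial_character UNIV z" "0 \<in> \<sigma>"
  shows "glued_via {0} z \<sigma> (chart_restrict \<sigma> z) z"
  using assms character_in_torus_chart[of z] chart_restrict_in_chart[of z \<sigma>]
  by (auto simp: glued_via_def chart_restrict_def)

lemma tendsto_fun_iff: "(f \<longlongrightarrow> l) F \<longleftrightarrow> (\<forall>i. ((\<lambda>c. f c i) \<longlongrightarrow> l i) F)"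
  using limitin_componentwise[of "\<lambda>_. euclidean" UNIV f l F]
  by (simp add: euclidean_product_topology)

lemma chart_restrict_tendsto:
  assumes "x \<in> chart_points \<sigma>" "\<And>m. m \<in> dual_monoid \<sigma> \<Longrightarrow> (\<lambda>k. Z k m) \<longlonglongrightarrow> x m"
  shows "(\<lambda>k. chart_restrict \<sigma> (Z k)) \<longlonglongrightarrow> x"
  unfolding tendsto_fun_iff
proof
  fix m show "(\<lambda>k. chart_restrict \<sigma> (Z k) m) \<longlonglongrightarrow> x m"
    using assms(2)[of m] chart_pointsD(3)[OF assms(1), of m]
    by (cases "m \<in> dual_monoid \<sigma>") (auto simp: chart_restrict_def)
qed

lemma laurent_coeff_mult_character: "laurent_coeff (s * character a) (m + a) = laurent_coeff s m"
proof -
  have "Poly_Mapping.lookup (poly_of s * Poly_Mapping.single a 1) (m + a) =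
      Poly_Mapping.lookup (poly_of s) m * Poly_Mapping.lookup (Poly_Mapping.single a 1) a"
    by (rule lookup_times_unique_sum) (auto split: if_splits)
  then show ?thesis
    by (simp add: laurent_coeff_def times_laurent.rep_eq character_def Laurent_inverse)
qed

lemma in_exponents_iff: "m \<in> exponents s \<longleftrightarrow> laurent_coeff s m \<noteq> 0"
  by (simp add: exponents_def laurent_coeff_def in_keys_iff)

lemma exponents_mult_character: "exponents (s * character a) = (\<lambda>m. m + a) ` exponents s"
proof -
  have "m \<in> exponents (s * character a) \<longleftrightarrow> m - a \<in> exponents s" for m
    using laurent_coeff_mult_character[of s a "m - a"] by (simp add: in_exponents_iff)
  moreover have "m \<in> (\<lambda>m. m + a) ` exponents s \<longleftrightarrow> m - a \<in> exponents s" for m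
    by (auto intro: rev_image_eqI[of "m - a"])
  ultimately show ?thesis by blast
qed

lemma laurent_eval_mult_character:
  "laurent_eval (s * character a) x = (\<Sum>m\<in>exponents s. of_int (laurent_coeff s m) * x (m + a))"
  unfolding laurent_eval_def exponents_mult_character
  by (subst sum.reindex) (auto simp: inj_on_def laurent_coeff_mult_character)

lemma in_chart_ring_mult_character:
  "(\<exists>f\<in>chart_ring \<sigma>. s = f * character a) \<longleftrightarrow> (\<forall>m\<in>exponents s. m - a \<in> dual_monoid \<sigma>)"
proof
  assume "\<exists>f\<in>chart_ring \<sigma>. s = f * character a"
  then show "\<forall>m\<in>exponents s. m - a \<in> dual_monoid \<sigma>"
    by (auto simp: exponents_mult_character chart_ring_def subset_iff)
next
  assume *: "\<forall>m\<in>exponents s. m - a \<in> dual_monoid \<sigma>"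
  have "character (- a) * character a = 1"
    by (simp add: character_def times_laurent.abs_eq mult_single one_laurent.abs_eq)
  then have "s = (s * character (- a)) * character a" by (metis mult.assoc mult.right_neutral)
  moreover have "s * character (- a) \<in> chart_ring \<sigma>"
    using * by (auto simp: chart_ring_def exponents_mult_character)
  ultimately show "\<exists>f\<in>chart_ring \<sigma>. s = f * character a" by blast
qed

lemma compact_torus_one_parameter: "(\<lambda>k. cis (pairing k w)) \<in> compact_torus"
  by (auto simp: compact_torus_def real_vec_add inner_add_left simp flip: cis_mult)

lemma compact_torus_mult:
  "t \<in> compact_torus \<Longrightarrow> t' \<in> compact_torus \<Longrightarrow> (\<lambda>m. t m * t' m) \<in> compact_torus"
  by (auto simp: compact_torus_def norm_mult)

lemma compact_torus_separates:
  fixes a :: "int ^ 'n::finite"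
  assumes "a \<noteq> 0"
  shows "\<exists>t\<in>compact_torus. t a = -1"
proof -
  obtain i where i: "a $ i \<noteq> 0" using assms by (auto simp: vec_eq_iff)
  let ?w = "axis i (pi / real_of_int (a $ i))"
  have "pairing a ?w = pi" using i by (simp add: inner_axis)
  then show ?thesis
    by (intro bexI[OF _ compact_torus_one_parameter[of ?w]]) simp
qed

text \<open>
  Averaging a trigonometric polynomial with its translate by a point \<open>t\<close> with \<open>t (k - m) = -1\<close>
  removes the monomial \<open>k\<close>, keeps the coefficient of \<open>m\<close> and does not increase the supremum.
\<close>

lemma fourier_coefficient_bound:
  fixes c :: "int ^ 'n::finite \<Rightarrow> complex"
  assumes "finite E" "m \<notin> E"
    and "\<And>t. t \<in> compact_torus \<Longrightarrow> cmod (c m * t m + (\<Sum>k\<in>E. c k * t k)) \<le> B"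
  shows "cmod (c m) \<le> B"
  using assms
proof (induction E arbitrary: c rule: finite_induct)
  case empty
  have one: "(\<lambda>_. 1) \<in> compact_torus" by (simp add: compact_torus_def)
  show ?case using empty.prems(2)[OF one] by simp
next
  case (insert k E)
  then have km: "k - m \<noteq> 0" by auto
  obtain t0 where t0: "t0 \<in> compact_torus" "t0 (k - m) = -1"
    using compact_torus_separates[OF km] by blast
  note D = partial_characterD[OF compact_torus_character[OF t0(1)]]
  define c' where "c' j = c j * (1 + t0 (j - m)) / 2" for j
  have t0m: "cmod (t0 m) = 1" using t0(1) by (simp add: compact_torus_def)
  have "cmod (c' m) \<le> B"
  proof (rule insert.IH)
    show "m \<notin> E" using insert.prems by simp
    fix t :: "int ^ 'n \<Rightarrow> complex" assume t: "t \<in> compact_torus"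
    let ?P = "\<lambda>t. c m * t m + (\<Sum>j\<in>insert k E. c j * t j)"
    let ?t' = "\<lambda>j. t0 j * t j"
    have avg: "c' j * t j = (c j * t j + c j * ?t' j / t0 m) / 2" for j
      using D(9)[of j m] by (simp add: c'_def field_simps)
    have ck: "c' k * t k = 0" using t0(2) by (simp add: c'_def)
    have "c' m * t m + (\<Sum>j\<in>E. c' j * t j) = c' m * t m + (\<Sum>j\<in>insert k E. c' j * t j)"
      using insert.hyps ck by simp
    also have "\<dots> = (?P t + ?P ?t' / t0 m) / 2"
      unfolding avg by (simp only: add_divide_distrib sum.distrib flip: sum_divide_distrib) simp
    finally have sum: "c' m * t m + (\<Sum>j\<in>E. c' j * t j) = (?P t + ?P ?t' / t0 m) / 2" .
    have "cmod (c' m * t m + (\<Sum>j\<in>E. c' j * t j)) = cmod (?P t + ?P ?t' / t0 m) / 2"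
      by (simp only: sum norm_divide norm_numeral)
    also have "\<dots> \<le> (cmod (?P t) + cmod (?P ?t' / t0 m)) / 2"
      by (intro divide_right_mono norm_triangle_ineq) simp
    also have "cmod (?P ?t' / t0 m) = cmod (?P ?t')" using t0m by (simp add: norm_divide)
    also have "(cmod (?P t) + cmod (?P ?t')) / 2 \<le> (B + B) / 2"
      by (intro divide_right_mono add_mono insert.prems(2) t compact_torus_mult[OF t0(1)]) simp
    finally show "cmod (c' m * t m + (\<Sum>j\<in>E. c' j * t j)) \<le> B" by simp
  qed
  then show ?case using D(6) by (simp add: c'_def)
qed

section \<open>Counting Laurent polynomials with bounded integer coefficients\<close>

lemma laurent_eqI: "laurent_coeff s = laurent_coeff s' \<Longrightarrow> s = s'"
  unfolding laurent_coeff_def by (metis lookup_inject poly_of_inject)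

lemma exists_laurent_coeff:
  assumes "finite {m. f m \<noteq> 0}"
  shows "\<exists>s. laurent_coeff s = f"
proof
  show "laurent_coeff (Laurent (Abs_poly_mapping f)) = f"
    using assms by (simp add: laurent_coeff_def Laurent_inverse lookup_Abs_poly_mapping)
qed

lemma bij_betw_bounded_laurent:
  assumes "finite E"
  shows "bij_betw (\<lambda>s. restrict (laurent_coeff s) E)
    {s. exponents s \<subseteq> E \<and> (\<forall>m\<in>E. \<bar>real_of_int (laurent_coeff s m)\<bar> \<le> b m)}
    (\<Pi>\<^sub>E m\<in>E. {- \<lfloor>b m\<rfloor>..\<lfloor>b m\<rfloor>})"
proof -
  let ?A = "{s. exponents s \<subseteq> E \<and> (\<forall>m\<in>E. \<bar>real_of_int (laurent_coeff s m)\<bar> \<le> b m)}"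
  have bound: "\<bar>real_of_int c\<bar> \<le> r \<longleftrightarrow> c \<in> {- \<lfloor>r\<rfloor>..\<lfloor>r\<rfloor>}" for c r
    by (auto simp: abs_le_iff le_floor_iff) linarith+
  show ?thesis
  proof (rule bij_betwI')
    fix s s' assume A: "s \<in> ?A" "s' \<in> ?A"
    show "restrict (laurent_coeff s) E = restrict (laurent_coeff s') E \<longleftrightarrow> s = s'"
    proof
      assume eq: "restrict (laurent_coeff s) E = restrict (laurent_coeff s') E"
      have "laurent_coeff s m = laurent_coeff s' m" for m
      proof (cases "m \<in> E")
        case True
        then show ?thesis using fun_cong[OF eq, of m] by simp
      next
        case False
        then have "m \<notin> exponents s" "m \<notin> exponents s'" using A by auto
        then show ?thesis by (simp add: in_exponents_iff)
      qed
      then show "s = s'" by (intro laurent_eqI ext)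
    qed simp
  next
    fix s assume "s \<in> ?A"
    then show "restrict (laurent_coeff s) E \<in> (\<Pi>\<^sub>E m\<in>E. {- \<lfloor>b m\<rfloor>..\<lfloor>b m\<rfloor>})"
      using bound by (auto simp: restrict_def)
  next
    fix f assume f: "f \<in> (\<Pi>\<^sub>E m\<in>E. {- \<lfloor>b m\<rfloor>..\<lfloor>b m\<rfloor>})"
    have "{m. (if m \<in> E then f m else 0) \<noteq> 0} \<subseteq> E" by auto
    then have "finite {m. (if m \<in> E then f m else 0) \<noteq> 0}" using assms by (rule finite_subset)
    from exists_laurent_coeff[OF this]
    obtain s where s: "laurent_coeff s = (\<lambda>m. if m \<in> E then f m else 0)" ..
    have "exponents s \<subseteq> E" by (auto simp: in_exponents_iff s split: if_splits)
    moreover have "\<bar>real_of_int (laurent_coeff s m)\<bar> \<le> b m" if "m \<in> E" for m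
      using f that by (simp add: bound s PiE_iff)
    moreover have "f = restrict (laurent_coeff s) E"
      using f by (auto simp: s fun_eq_iff PiE_iff extensional_def)
    ultimately show "\<exists>s\<in>?A. f = restrict (laurent_coeff s) E" by blast
  qed
qed

lemma bounded_laurent_finite:
  assumes "finite E"
  shows "finite {s. exponents s \<subseteq> E \<and> (\<forall>m\<in>E. \<bar>real_of_int (laurent_coeff s m)\<bar> \<le> b m)}"
  unfolding bij_betw_finite[OF bij_betw_bounded_laurent[OF assms]]
  by (intro finite_PiE assms) simp

lemma card_bounded_laurent:
  assumes "finite E"
  shows "card {s. exponents s \<subseteq> E \<and> (\<forall>m\<in>E. \<bar>real_of_int (laurent_coeff s m)\<bar> \<le> b m)}
    = (\<Prod>m\<in>E. nat (2 * \<lfloor>b m\<rfloor> + 1))"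
  unfolding bij_betw_same_card[OF bij_betw_bounded_laurent[OF assms]] card_PiE[OF assms]
  by (intro prod.cong refl) simp

section \<open>Small sections\<close>

locale metrized_toric_divisor =
  fixes \<Sigma> :: "(real ^ 'n::finite) set set"
    and \<psi> :: "real ^ 'n \<Rightarrow> real"
    and \<mu> :: "(real ^ 'n) set \<Rightarrow> int ^ 'n"
    and h :: "(real ^ 'n) set \<Rightarrow> (int ^ 'n \<Rightarrow> complex) \<Rightarrow> real"
  assumes fan: "is_fan \<Sigma>"
    and complete: "\<And>u. \<exists>\<sigma>\<in>\<Sigma>. u \<in> \<sigma>"
    and divisor: "equivariant_divisor \<Sigma> \<psi> \<mu>"
    and metric: "continuous_hermitian_metric \<Sigma> \<mu> h"
    and invariant: "compact_torus_invariant \<Sigma> h"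
begin

abbreviation "g \<equiv> g_metric \<mu> h"
abbreviation "\<Theta> \<equiv> theta_set \<psi> g"
abbreviation "roof x \<equiv> real_of_ereal (legendre_fenchel g x)"

text \<open>The norm of \<open>s_D\<close> at a torus point: 1 is
  \<open>character (- \<mu> {0})\<close> times the frame. The exponent \<open>\<mu> {0}\<close> need
  not vanish, since \<psi> puts no constraint on it.\<close>

definition torus_norm :: "(int ^ 'n \<Rightarrow> complex) \<Rightarrow> real" where
  "torus_norm z = cmod (z (- \<mu> {0})) * h {0} z"

lemma cone: "\<sigma> \<in> \<Sigma> \<Longrightarrow> strongly_convex_rational_cone \<sigma>"
  using fan by (auto simp: is_fan_def)

lemma zero_cone: "{0} \<in> \<Sigma>"
  using zero_cone_in_fan[OF fan] .

lemma zero_in_cone: "\<sigma> \<in> \<Sigma> \<Longrightarrow> 0 \<in> \<sigma>"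
  using cone by (auto simp: strongly_convex_rational_cone_def)

lemma metric_pos: "\<sigma> \<in> \<Sigma> \<Longrightarrow> x \<in> chart_points \<sigma> \<Longrightarrow> 0 < h \<sigma> x"
  using metric by (auto simp: continuous_hermitian_metric_def)

lemma section_norm_torus:
  assumes z: "partial_character UNIV z"
  shows "section_norm \<mu> h l s {0} z = cmod (laurent_eval s z) * torus_norm z ^ l"
proof -
  note D = partial_characterD[OF z, simplified]
  have "z (- (int l *s \<mu> {0})) = z (- \<mu> {0}) ^ l"
    using partial_character_scale(2)[OF z, of "- \<mu> {0}" "int l"]
    by (simp add: vector_smult_rneg)
  then have "laurent_eval (s * character (- (int l *s \<mu> {0}))) z = laurent_eval s z * z (- \<mu> {0}) ^ l"
    unfolding laurent_eval_mult_character D(4) by (simp add: laurent_eval_def sum_distrib_right mult.assoc)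
  then show ?thesis
    by (simp add: section_norm_def torus_norm_def norm_mult norm_power power_mult_distrib)
qed

lemma torus_norm_pos: "partial_character UNIV z \<Longrightarrow> 0 < torus_norm z"
  using partial_characterD(5)[of UNIV z] metric_pos[OF zero_cone character_in_torus_chart]
  by (simp add: torus_norm_def)

text \<open>Torus points with equal moduli differ by an element of the compact torus, so invariance
  reduces \<open>z\<close> to \<open>torus_exp_neg u\<close>.\<close>

lemma torus_norm_eq:
  assumes z: "partial_character UNIV z" and u: "\<And>m. cmod (z m) = exp (- pairing m u)"
  shows "torus_norm z = exp (g u)"
proof -
  let ?e = "torus_exp_neg u"
  note e = torus_exp_neg_character[of u]
  have e0: "?e m \<noteq> 0" for m using partial_characterD(5)[OF e] by simp
  have "exponents (1 :: 'n laurent) = {0}" using exponents_character[of "0 :: int ^ 'n"] by simp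
  moreover have "laurent_coeff (1 :: 'n laurent) 0 = 1"
    by (simp add: laurent_coeff_def one_laurent.rep_eq)
  ultimately have "laurent_eval 1 ?e = 1"
    using partial_characterD(6)[OF e] by (simp add: laurent_eval_def)
  then have g: "exp (g u) = torus_norm ?e"
    unfolding g_metric_def section_norm_torus[OF e] using torus_norm_pos[OF e] by simp
  define t where "t m = z m / ?e m" for m
  have "partial_character UNIV t" unfolding t_def by (intro partial_character_divide z e)
  then have "t \<in> compact_torus"
    using u by (auto simp: compact_torus_def t_def partial_character_def norm_divide cmod_torus_exp_neg)
  then have "h {0} (\<lambda>m. t m * ?e m) = h {0} ?e"
    using invariant zero_cone character_in_torus_chart[OF e] by (auto simp: compact_torus_invariant_def)
  moreover have "(\<lambda>m. t m * ?e m) = z" using e0 by (simp add: t_def)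
  ultimately have "h {0} z = h {0} ?e" by simp
  then show ?thesis unfolding g torus_norm_def by (simp add: u cmod_torus_exp_neg)
qed

lemma chart_norm_torus:
  assumes "\<sigma> \<in> \<Sigma>" "partial_character UNIV z"
  shows "h \<sigma> (chart_restrict \<sigma> z) = cmod (z (\<mu> \<sigma> - \<mu> {0})) * h {0} z"
  using metric glued_via_torus[OF assms(2) zero_in_cone[OF assms(1)]] assms(1) zero_cone
  unfolding continuous_hermitian_metric_def by blast

text \<open>The transition rule cancels \<open>\<mu> \<sigma>\<close>: the left side is the modulus
  of the character at \<open>z\<close> times \<open>torus_norm z ^ l\<close>, that is exp(l g(u) -
  <m,u>) for the tropicalization u of \<open>z\<close>.\<close>

lemma character_norm_torus:
  assumes \<sigma>: "\<sigma> \<in> \<Sigma>" and z: "partial_character UNIV z"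
    and m: "m - int l *s \<mu> \<sigma> \<in> dual_monoid \<sigma>" and C: "\<And>u. real l * g u - pairing m u \<le> C"
  shows "cmod (chart_restrict \<sigma> z (m - int l *s \<mu> \<sigma>)) * h \<sigma> (chart_restrict \<sigma> z) ^ l \<le> exp C"
proof -
  note D = partial_characterD[OF z, simplified]
  obtain u where u: "\<And>m. cmod (z m) = exp (- pairing m u)"
    using partial_character_cmod[OF z] by blast
  have "cmod (z (m - int l *s \<mu> \<sigma>)) * (cmod (z (\<mu> \<sigma> - \<mu> {0})) * h {0} z) ^ l
      = cmod (z m) * torus_norm z ^ l"
    using partial_character_scale(2)[OF z, of "\<mu> \<sigma>" "int l"] D(5)
    by (simp add: D(9,7) torus_norm_def norm_divide norm_inverse norm_power power_mult_distrib power_divide field_simps)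
  also have "\<dots> = exp (real l * g u - pairing m u)"
    by (simp add: torus_norm_eq[OF z u] u exp_diff exp_minus divide_inverse mult.commute flip: exp_of_nat_mult)
  also have "\<dots> \<le> exp C" using C by simp
  finally show ?thesis
    using m unfolding chart_norm_torus[OF \<sigma> z] by (simp add: chart_restrict_def)
qed

text \<open>Continuity of \<open>h \<sigma>\<close> carries the bound from the torus to its limit
  points in the chart.\<close>

lemma character_norm_le:
  assumes \<sigma>: "\<sigma> \<in> \<Sigma>" and x: "x \<in> chart_points \<sigma>"
    and m: "m - int l *s \<mu> \<sigma> \<in> dual_monoid \<sigma>" and C: "\<And>u. real l * g u - pairing m u \<le> C"
  shows "cmod (x (m - int l *s \<mu> \<sigma>)) * h \<sigma> x ^ l \<le> exp C"
proof -
  obtain Z where Z: "\<And>k. partial_character UNIV (Z k)"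
      "\<And>m. m \<in> dual_monoid \<sigma> \<Longrightarrow> (\<lambda>k. Z k m) \<longlonglongrightarrow> x m"
    using torus_dense_in_chart[OF cone[OF \<sigma>] x] by blast
  let ?R = "\<lambda>k. chart_restrict \<sigma> (Z k)"
  have R: "?R \<longlonglongrightarrow> x" using chart_restrict_tendsto[OF x Z(2)] .
  have "continuous_on (chart_points \<sigma>) (h \<sigma>)"
    using metric \<sigma> by (auto simp: continuous_hermitian_metric_def)
  then have "(\<lambda>k. h \<sigma> (?R k)) \<longlonglongrightarrow> h \<sigma> x"
    by (rule continuous_on_tendsto_compose[OF _ R x])
      (use chart_restrict_in_chart[OF Z(1)] in auto)
  moreover have "(\<lambda>k. ?R k (m - int l *s \<mu> \<sigma>)) \<longlonglongrightarrow> x (m - int l *s \<mu> \<sigma>)"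
    using R unfolding tendsto_fun_iff by blast
  ultimately have "(\<lambda>k. cmod (?R k (m - int l *s \<mu> \<sigma>)) * h \<sigma> (?R k) ^ l)
      \<longlonglongrightarrow> cmod (x (m - int l *s \<mu> \<sigma>)) * h \<sigma> x ^ l"
    by (intro tendsto_mult tendsto_norm tendsto_power)
  then show ?thesis
    by (rule LIMSEQ_le_const2) (use character_norm_torus[OF \<sigma> Z(1) m C] in blast)
qed

section \<open>Exponents and coefficients of global and small sections\<close>

lemma divisor_eq: "\<sigma> \<in> \<Sigma> \<Longrightarrow> u \<in> \<sigma> \<Longrightarrow> \<psi> u = pairing (\<mu> \<sigma>) u"
  using divisor by (auto simp: equivariant_divisor_def)

text \<open>Regularity on the chart of \<sigma> is the inequality defining the polytope for u in
  \<sigma>; by completeness the cones account for every u.\<close>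

lemma global_sections_iff:
  assumes "l > 0"
  shows "s \<in> global_sections \<Sigma> \<mu> l \<longleftrightarrow>
    (\<forall>m\<in>exponents s. real_vec m /\<^sub>R real l \<in> divisor_polytope \<psi>)"
proof -
  have *: "pairing (m - int l *s \<mu> \<sigma>) u \<ge> 0 \<longleftrightarrow> (real_vec m /\<^sub>R real l) \<bullet> u \<ge> \<psi> u"
    if "\<sigma> \<in> \<Sigma>" "u \<in> \<sigma>" for \<sigma> u m
    using assms divisor_eq[OF that]
    by (simp add: real_vec_minus real_vec_scale inner_diff_left field_simps)
  have "s \<in> global_sections \<Sigma> \<mu> l \<longleftrightarrow>
      (\<forall>m\<in>exponents s. \<forall>\<sigma>\<in>\<Sigma>. \<forall>u\<in>\<sigma>. pairing (m - int l *s \<mu> \<sigma>) u \<ge> 0)"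
    unfolding global_sections_def in_chart_ring_mult_character dual_monoid_def by auto
  also have "\<dots> \<longleftrightarrow> (\<forall>m\<in>exponents s. \<forall>\<sigma>\<in>\<Sigma>. \<forall>u\<in>\<sigma>. (real_vec m /\<^sub>R real l) \<bullet> u \<ge> \<psi> u)"
    using * by (intro ball_cong refl)
  also have "\<dots> \<longleftrightarrow> (\<forall>m\<in>exponents s. real_vec m /\<^sub>R real l \<in> divisor_polytope \<psi>)"
    using complete unfolding divisor_polytope_def by blast
  finally show ?thesis .
qed

text \<open>For each u the Fourier bound on the orbit of \<open>torus_exp_neg u\<close> gives ln |c|
  / l \<le> <x,u> - g(u) with x = m/l. The infimum over u is the coefficient bound; since |c| \<ge>
  1 the left side is nonnegative, which places x in \<Theta>.\<close>

lemma small_section_coeff: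
  assumes l: "l > 0" and s: "s \<in> small_sections \<Sigma> \<mu> h l" and m: "m \<in> exponents s"
  shows "real_vec m /\<^sub>R real l \<in> \<Theta>"
    and "\<bar>real_of_int (laurent_coeff s m)\<bar> \<le> exp (real l * roof (real_vec m /\<^sub>R real l))"
proof -
  let ?x = "real_vec m /\<^sub>R real l" and ?c = "\<bar>real_of_int (laurent_coeff s m)\<bar>"
  have c1: "1 \<le> ?c" using m by (simp add: in_exponents_iff)
  have bound: "ln ?c / real l \<le> ?x \<bullet> u - g u" for u
  proof -
    let ?e = "torus_exp_neg u"
    let ?a = "\<lambda>k. of_int (laurent_coeff s k) * ?e k"
    \<comment> \<open>On this orbit \<open>torus_norm\<close> is constantly exp(g(u)), so smallness
      bounds |s| there by exp(-l g(u)).\<close>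
    have "cmod (?a m) \<le> exp (- real l * g u)"
    proof (rule fourier_coefficient_bound)
      show "finite (exponents s - {m})" "m \<notin> exponents s - {m}" by auto
      fix t :: "int ^ 'n \<Rightarrow> complex" assume t: "t \<in> compact_torus"
      let ?z = "\<lambda>k. ?e k * t k"
      have z: "partial_character UNIV ?z"
        by (intro partial_character_mult torus_exp_neg_character compact_torus_character t)
      have zu: "cmod (?z k) = exp (- pairing k u)" for k
        using t by (simp add: norm_mult cmod_torus_exp_neg compact_torus_def)
      have "ereal (section_norm \<mu> h l s {0} ?z) \<le> sup_norm \<Sigma> \<mu> h l s"
        unfolding sup_norm_def charted_points_def
        using zero_cone character_in_torus_chart[OF z] by (intro SUP_upper2[of "({0}, ?z)"]) auto
      also have "\<dots> \<le> 1" using s by (simp add: small_sections_def)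
      finally have "section_norm \<mu> h l s {0} ?z \<le> 1" by simp
      then have "cmod (laurent_eval s ?z) * exp (real l * g u) \<le> 1"
        unfolding section_norm_torus[OF z] torus_norm_eq[OF z zu] by (simp flip: exp_of_nat_mult)
      then have "cmod (laurent_eval s ?z) \<le> exp (- real l * g u)"
        by (simp add: exp_minus field_simps)
      moreover have "laurent_eval s ?z = ?a m * t m + (\<Sum>k\<in>exponents s - {m}. ?a k * t k)"
        unfolding laurent_eval_def using m by (simp add: sum.remove mult.assoc)
      ultimately show "cmod (?a m * t m + (\<Sum>k\<in>exponents s - {m}. ?a k * t k)) \<le> exp (- real l * g u)"
        by simp
    qed
    then have "?c * exp (- pairing m u) \<le> exp (- real l * g u)"
      by (simp add: norm_mult cmod_torus_exp_neg)
    then have "?c \<le> exp (pairing m u - real l * g u)"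
      by (simp add: exp_minus exp_diff field_simps)
    then have "ln ?c \<le> ln (exp (pairing m u - real l * g u))"
      using c1 by (subst ln_le_cancel_iff) auto
    then have "ln ?c \<le> pairing m u - real l * g u" by simp
    then show ?thesis using l by (simp add: field_simps)
  qed
  have "0 \<le> ?x \<bullet> u - g u" for u
    by (rule order_trans[OF _ bound]) (use c1 in simp)
  then have pos: "0 \<le> legendre_fenchel g ?x"
    unfolding legendre_fenchel_def by (intro INF_greatest) simp
  moreover have "?x \<in> divisor_polytope \<psi>"
    using s m global_sections_iff[OF l] by (auto simp: small_sections_def)
  ultimately show "?x \<in> \<Theta>" by (simp add: theta_set_def)
  have "ln ?c / real l \<le> roof ?x"
    by (rule legendre_fenchel_real_ge[OF pos bound])
  then have "ln ?c \<le> real l * roof ?x" using l by (simp add: field_simps)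
  then show "?c \<le> exp (real l * roof ?x)" using c1 by (subst (asm) exp_le_cancel_iff[symmetric]) simp
qed

text \<open>The divisor \<open>card E\<close> pays for the triangle inequality over at most that
  many monomials.\<close>

lemma small_sectionI:
  assumes l: "l > 0" and fin: "finite E" and E: "\<And>m. m \<in> E \<Longrightarrow> real_vec m /\<^sub>R real l \<in> \<Theta>"
    and s: "exponents s \<subseteq> E"
    and c: "\<And>m. m \<in> E \<Longrightarrow>
      \<bar>real_of_int (laurent_coeff s m)\<bar> \<le> exp (real l * roof (real_vec m /\<^sub>R real l)) / real (card E)"
  shows "s \<in> small_sections \<Sigma> \<mu> h l"
proof -
  have glob: "s \<in> global_sections \<Sigma> \<mu> l"
    using global_sections_iff[OF l] E s by (auto simp: theta_set_def)
  have "section_norm \<mu> h l s \<sigma> x \<le> 1" if \<sigma>: "\<sigma> \<in> \<Sigma>" and x: "x \<in> chart_points \<sigma>" for \<sigma> x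
  proof -
    let ?c = "\<lambda>m. \<bar>real_of_int (laurent_coeff s m)\<bar>"
    let ?n = "\<lambda>m. cmod (x (m - int l *s \<mu> \<sigma>)) * h \<sigma> x ^ l"
    have hl: "0 \<le> h \<sigma> x ^ l" using metric_pos[OF \<sigma> x] by simp
    have le: "?c m * ?n m \<le> 1 / real (card E)" if m: "m \<in> exponents s" for m
    proof -
      let ?y = "real_vec m /\<^sub>R real l"
      have y: "0 \<le> legendre_fenchel g ?y" using E s m by (auto simp: theta_set_def)
      have "m - int l *s \<mu> \<sigma> \<in> dual_monoid \<sigma>"
        using glob \<sigma> m unfolding global_sections_def in_chart_ring_mult_character by auto
      moreover have "real l * g u - pairing m u \<le> - real l * roof ?y" for u
      proof -
        have "real l * roof ?y \<le> real l * (?y \<bullet> u - g u)"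
          by (intro mult_left_mono legendre_fenchel_real_le y) simp
        also have "\<dots> = pairing m u - real l * g u"
          using l by (simp add: right_diff_distrib)
        finally show ?thesis by simp
      qed
      ultimately have "?n m \<le> exp (- real l * roof ?y)"
        by (rule character_norm_le[OF \<sigma> x])
      then have "?c m * ?n m \<le> exp (real l * roof ?y) / real (card E) * exp (- real l * roof ?y)"
        using c[of m] s m hl by (intro mult_mono) auto
      then show ?thesis by (simp add: exp_minus)
    qed
    have "section_norm \<mu> h l s \<sigma> x =
        cmod (\<Sum>m\<in>exponents s. of_int (laurent_coeff s m) * x (m - int l *s \<mu> \<sigma>)) * h \<sigma> x ^ l"
      by (simp add: section_norm_def laurent_eval_mult_character)
    also have "\<dots> \<le> (\<Sum>m\<in>exponents s. ?c m * cmod (x (m - int l *s \<mu> \<sigma>))) * h \<sigma> x ^ l"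
      by (intro mult_right_mono hl order_trans[OF norm_sum] sum_mono) (simp add: norm_mult)
    also have "\<dots> = (\<Sum>m\<in>exponents s. ?c m * ?n m)"
      by (simp add: sum_distrib_right mult.assoc)
    also have "\<dots> \<le> (\<Sum>m\<in>exponents s. 1 / real (card E))"
      by (intro sum_mono le)
    also have "\<dots> \<le> 1"
      \<comment> \<open>If \<open>E\<close> is empty, division by zero gives 0 and the bound still
        holds; this covers the zero section.\<close>
      using card_mono[OF fin s] by (cases "card E = 0") (simp_all add: divide_le_eq)
    finally show ?thesis .
  qed
  then have "sup_norm \<Sigma> \<mu> h l s \<le> 1"
    unfolding sup_norm_def charted_points_def by (intro SUP_least) auto
  with glob show ?thesis by (simp add: small_sections_def)
qed

subsection \<open>Asymptotic count\<close>

text \<open>The inequalities at plus and minus each basis vector bound every coordinate on both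
  sides.\<close>

lemma bounded_divisor_polytope: "bounded (divisor_polytope \<psi>)"
proof -
  let ?B = "Max ((\<lambda>i. max \<bar>\<psi> (axis i 1)\<bar> \<bar>\<psi> (- axis i 1)\<bar>) ` (UNIV :: 'n set))"
  have "norm x \<le> (\<Sum>i\<in>(UNIV :: 'n set). ?B)" if x: "x \<in> divisor_polytope \<psi>" for x
  proof -
    have "\<bar>x $ i\<bar> \<le> ?B" for i
    proof -
      have "\<psi> (axis i 1) \<le> x \<bullet> axis i 1" "\<psi> (- axis i 1) \<le> x \<bullet> (- axis i 1)"
        using x unfolding divisor_polytope_def by blast+
      then have "\<bar>x $ i\<bar> \<le> max \<bar>\<psi> (axis i 1)\<bar> \<bar>\<psi> (- axis i 1)\<bar>"
        by (auto simp: inner_axis)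
      also have "\<dots> \<le> ?B" by (intro Max_ge) auto
      finally show ?thesis .
    qed
    then have "(\<Sum>i\<in>UNIV. \<bar>x $ i\<bar>) \<le> (\<Sum>i\<in>(UNIV :: 'n set). ?B)" by (rule sum_mono)
    then show ?thesis using norm_le_l1_cart[of x] by (rule order_trans[rotated])
  qed
  then show ?thesis by (rule boundedI)
qed

lemma divisor_polytope_altdef: "divisor_polytope \<psi> = (\<Inter>u. {x. \<psi> u \<le> x \<bullet> u})"
  by (auto simp: divisor_polytope_def)

lemma closed_divisor_polytope: "closed (divisor_polytope \<psi>)"
  unfolding divisor_polytope_altdef
  by (intro closed_INT ballI) (auto intro!: closed_Collect_le continuous_intros)

lemma convex_divisor_polytope: "convex (divisor_polytope \<psi>)"
  unfolding divisor_polytope_altdef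
  by (intro convex_INT) (auto simp: inner_commute[of _ "_ :: real ^ 'n"] convex_halfspace_ge)

lemma theta_eq_superlevel: "\<Theta> = superlevel g (divisor_polytope \<psi>) 0"
  by (simp add: theta_set_def superlevel_def zero_ereal_def)

lemma bounded_theta: "bounded \<Theta>"
  using bounded_divisor_polytope by (rule bounded_subset) (auto simp: theta_set_def)

definition theta_points :: "nat \<Rightarrow> (int ^ 'n) set" where
  "theta_points l = {m. real_vec m /\<^sub>R real l \<in> \<Theta>}"

definition roof_sum :: "nat \<Rightarrow> real" where
  "roof_sum l = (\<Sum>m\<in>theta_points l. roof (real_vec m /\<^sub>R real l))"

lemma finite_theta_points: "l > 0 \<Longrightarrow> finite (theta_points l)"
  unfolding theta_points_def by (rule finite_lattice_points[OF bounded_theta])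

lemma roof_bounds: "x \<in> \<Theta> \<Longrightarrow> 0 \<le> roof x \<and> roof x \<le> - g 0"
  using legendre_fenchel_real_le[of g x 0] by (auto simp: theta_set_def real_of_ereal_pos)

lemma roof_sum_tendsto:
  "(\<lambda>l. roof_sum l / real l ^ CARD('n)) \<longlonglongrightarrow> (LINT x : \<Theta> | lborel. roof x)"
proof -
  let ?f = "\<lambda>x. indicator \<Theta> x * roof x"
  have "(\<lambda>l. (\<Sum>m | real_vec m /\<^sub>R real l \<in> \<Theta>. ?f (real_vec m /\<^sub>R real l)) / real l ^ CARD('n))
      \<longlonglongrightarrow> integral\<^sup>L lborel ?f"
  proof (rule lattice_riemann_sum[OF bounded_theta, where B = "\<bar>g 0\<bar>"])
    show "\<bar>?f x\<bar> \<le> \<bar>g 0\<bar>" for x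
      using roof_bounds[of x] by (auto simp: indicator_def)
    show "?f \<in> borel_measurable borel"
      unfolding theta_eq_superlevel by (rule legendre_fenchel_measurable[OF closed_divisor_polytope])
    show "AE x in lborel. isCont ?f x"
      unfolding theta_eq_superlevel
      by (rule legendre_fenchel_isCont_AE[OF convex_divisor_polytope closed_divisor_polytope])
  qed simp
  moreover have "(\<Sum>m | real_vec m /\<^sub>R real l \<in> \<Theta>. ?f (real_vec m /\<^sub>R real l)) = roof_sum l" for l
    unfolding roof_sum_def theta_points_def by (intro sum.cong) auto
  ultimately show ?thesis by (simp add: set_lebesgue_integral_def)
qed

lemma card_theta_points_tendsto:
  "(\<lambda>l. real (card (theta_points l)) / real l ^ CARD('n)) \<longlonglongrightarrow> measure lborel \<Theta>"
proof -
  \<comment> \<open>The factor 1 gives the product form of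
    \<open>isCont_restrict_AE\<close>.\<close>
  let ?f = "\<lambda>x. indicator \<Theta> x * 1 :: real"
  have closed: "closed \<Theta>" and convex: "convex \<Theta>"
    unfolding theta_eq_superlevel
    by (rule closed_superlevel[OF closed_divisor_polytope] convex_superlevel[OF convex_divisor_polytope])+
  have "(\<lambda>l. (\<Sum>m | real_vec m /\<^sub>R real l \<in> \<Theta>. ?f (real_vec m /\<^sub>R real l)) / real l ^ CARD('n))
      \<longlonglongrightarrow> integral\<^sup>L lborel ?f"
  proof (rule lattice_riemann_sum[OF bounded_theta, where B = 1])
    show "AE x in lborel. isCont ?f x"
      by (rule isCont_restrict_AE[OF convex closed]) (rule continuous_on_const)
    show "?f \<in> borel_measurable borel" using closed by simp
  qed (auto simp: indicator_def)
  moreover have "(\<Sum>m | real_vec m /\<^sub>R real l \<in> \<Theta>. ?f (real_vec m /\<^sub>R real l)) = real (card (theta_points l))" for l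
    by (simp add: theta_points_def)
  ultimately show ?thesis using closed by simp
qed

lemma ln_card_small_sections_le:
  assumes l: "l > 0"
  shows "ln (real (card (small_sections \<Sigma> \<mu> h l))) \<le>
    real l * roof_sum l + real (card (theta_points l)) * ln 3"
    and "finite (small_sections \<Sigma> \<mu> h l)"
proof -
  let ?E = "theta_points l" and ?b = "\<lambda>m. exp (real l * roof (real_vec m /\<^sub>R real l))"
  let ?A = "{s. exponents s \<subseteq> ?E \<and> (\<forall>m\<in>?E. \<bar>real_of_int (laurent_coeff s m)\<bar> \<le> ?b m)}"
  note fin = finite_theta_points[OF l]
  have "\<bar>real_of_int (laurent_coeff s m)\<bar> \<le> ?b m" if "s \<in> small_sections \<Sigma> \<mu> h l" for s m
    using small_section_coeff(2)[OF l that, of m] by (cases "m \<in> exponents s") (auto simp: in_exponents_iff)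
  then have sub: "small_sections \<Sigma> \<mu> h l \<subseteq> ?A"
    using small_section_coeff(1)[OF l] by (auto simp: theta_points_def)
  then show "finite (small_sections \<Sigma> \<mu> h l)"
    using bounded_laurent_finite[OF fin] by (rule finite_subset)
  \<comment> \<open>The zero section makes the count positive, as monotonicity of the logarithm
    requires.\<close>
  have "0 \<in> small_sections \<Sigma> \<mu> h l"
    by (rule small_sectionI[OF l, of "{}"]) auto
  then have pos: "0 < card (small_sections \<Sigma> \<mu> h l)"
    using \<open>finite (small_sections \<Sigma> \<mu> h l)\<close> by (auto simp: card_gt_0_iff)
  have "real (card (small_sections \<Sigma> \<mu> h l)) \<le> real (card ?A)"
    using card_mono[OF bounded_laurent_finite[OF fin] sub] by simp
  also have "\<dots> = (\<Prod>m\<in>?E. real (nat (2 * \<lfloor>?b m\<rfloor> + 1)))"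
    by (simp add: card_bounded_laurent[OF fin])
  \<comment> \<open>On \<Theta> the transform is nonnegative, so b \<ge> 1 and 2 floor(b) + 1 \<le>
    3 b.\<close>
  also have "\<dots> \<le> (\<Prod>m\<in>?E. 3 * ?b m)"
  proof (rule prod_mono)
    fix m assume "m \<in> ?E"
    then have "1 \<le> ?b m" using roof_bounds by (simp add: theta_points_def)
    then show "0 \<le> real (nat (2 * \<lfloor>?b m\<rfloor> + 1)) \<and> real (nat (2 * \<lfloor>?b m\<rfloor> + 1)) \<le> 3 * ?b m"
      by linarith
  qed
  finally have "ln (real (card (small_sections \<Sigma> \<mu> h l))) \<le> ln (\<Prod>m\<in>?E. 3 * ?b m)"
    using pos by (subst ln_le_cancel_iff) (auto intro!: prod_pos)
  also have "\<dots> = (\<Sum>m\<in>?E. ln 3 + real l * roof (real_vec m /\<^sub>R real l))"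
    using fin by (simp add: ln_prod ln_mult)
  finally show "ln (real (card (small_sections \<Sigma> \<mu> h l))) \<le>
      real l * roof_sum l + real (card (theta_points l)) * ln 3"
    by (simp add: roof_sum_def sum.distrib sum_distrib_left)
qed

lemma ln_card_small_sections_ge:
  assumes l: "l > 0"
  shows "real l * roof_sum l - real (card (theta_points l)) * ln (real (card (theta_points l))) \<le>
    ln (real (card (small_sections \<Sigma> \<mu> h l)))"
proof -
  let ?E = "theta_points l"
  let ?b = "\<lambda>m. exp (real l * roof (real_vec m /\<^sub>R real l)) / real (card ?E)"
  let ?A = "{s. exponents s \<subseteq> ?E \<and> (\<forall>m\<in>?E. \<bar>real_of_int (laurent_coeff s m)\<bar> \<le> ?b m)}"
  note fin = finite_theta_points[OF l]
  have pos: "0 < ?b m" if "m \<in> ?E" for m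
    using that fin by (intro divide_pos_pos) (auto simp: card_gt_0_iff)
  have sub: "?A \<subseteq> small_sections \<Sigma> \<mu> h l"
    by (auto intro!: small_sectionI[OF l fin] simp: theta_points_def)
  have "real l * roof_sum l - real (card ?E) * ln (real (card ?E)) =
      (\<Sum>m\<in>?E. real l * roof (real_vec m /\<^sub>R real l) - ln (real (card ?E)))"
    by (simp add: roof_sum_def sum_subtractf sum_distrib_left)
  also have "\<dots> = (\<Sum>m\<in>?E. ln (?b m))"
    using fin by (intro sum.cong refl) (auto simp: ln_div card_gt_0_iff)
  also have "\<dots> = ln (\<Prod>m\<in>?E. ?b m)"
    using fin pos by (intro ln_prod[symmetric]) auto
  also have "\<dots> \<le> ln (real (card (small_sections \<Sigma> \<mu> h l)))"
  proof -
    \<comment> \<open>Here b may be below 1; the coefficient 0 is still allowed, so the factor is 1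
      and still at least b.\<close>
    have "(\<Prod>m\<in>?E. ?b m) \<le> (\<Prod>m\<in>?E. real (nat (2 * \<lfloor>?b m\<rfloor> + 1)))"
    proof (rule prod_mono)
      fix m assume "m \<in> ?E"
      then have "0 \<le> \<lfloor>?b m\<rfloor>" "0 \<le> ?b m" using pos[of m] by auto
      then show "0 \<le> ?b m \<and> ?b m \<le> real (nat (2 * \<lfloor>?b m\<rfloor> + 1))" by linarith
    qed
    also have "\<dots> = real (card ?A)" by (simp add: card_bounded_laurent[OF fin])
    also have "\<dots> \<le> real (card (small_sections \<Sigma> \<mu> h l))"
      using card_mono[OF ln_card_small_sections_le(2)[OF l] sub] by simp
    finally have le: "(\<Prod>m\<in>?E. ?b m) \<le> real (card (small_sections \<Sigma> \<mu> h l))" .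
    have "0 < (\<Prod>m\<in>?E. ?b m)" using pos by (rule prod_pos)
    then show ?thesis using le by (subst ln_le_cancel_iff) auto
  qed
  finally show ?thesis .
qed

text \<open>The number of lattice points is at most K l^d, so its logarithm is O(log l); an empty
  set falls under \<open>ln 0 = 0\<close>.\<close>

lemma ln_card_theta_points_over_n: "(\<lambda>l. ln (real (card (theta_points l))) / real l) \<longlonglongrightarrow> 0"
proof -
  obtain K where K: "K > 0" "\<And>l. norm (real (card (theta_points l)) / real l ^ CARD('n)) \<le> K"
    using convergent_imp_Bseq[OF convergentI[OF card_theta_points_tendsto]] by (auto elim: BseqE)
  show ?thesis
  proof (rule tendsto_sandwich)
    show "\<forall>\<^sub>F l in sequentially. 0 \<le> ln (real (card (theta_points l))) / real l"
    proof (intro always_eventually allI divide_nonneg_nonneg)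
      have "0 \<le> ln (real n)" for n by (cases n) auto
      then show "0 \<le> ln (real (card (theta_points l)))" for l .
    qed simp
    show "\<forall>\<^sub>F l in sequentially. ln (real (card (theta_points l))) / real l \<le>
        \<bar>ln K\<bar> / real l + real CARD('n) * (ln (real l) / real l)"
      using eventually_gt_at_top[of 0]
    proof eventually_elim
      case (elim l)
      have "ln (real (card (theta_points l))) \<le> \<bar>ln K\<bar> + real CARD('n) * ln (real l)"
      proof (cases "card (theta_points l) = 0")
        case True
        then show ?thesis using elim by simp
      next
        case False
        have "real (card (theta_points l)) \<le> K * real l ^ CARD('n)"
          using K(2)[of l] elim by (simp add: divide_le_eq)
        then have "ln (real (card (theta_points l))) \<le> ln (K * real l ^ CARD('n))"
          using False K(1) elim by (subst ln_le_cancel_iff) auto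
        also have "\<dots> = ln K + real CARD('n) * ln (real l)"
          using K(1) elim by (simp add: ln_mult ln_realpow)
        finally show ?thesis by simp
      qed
      then show ?case using elim by (simp add: field_simps)
    qed
    have "(\<lambda>l. \<bar>ln K\<bar> / real l + real CARD('n) * (ln (real l) / real l)) \<longlonglongrightarrow> 0 + real CARD('n) * 0"
      by (intro tendsto_add tendsto_mult tendsto_const lim_const_over_n lim_ln_over_n)
    then show "(\<lambda>l. \<bar>ln K\<bar> / real l + real CARD('n) * (ln (real l) / real l)) \<longlonglongrightarrow> 0" by simp
  qed simp
qed

text \<open>After division by l^(d+1) each error term is the convergent ratio \<open>?N l\<close>
  times a null sequence: ln N / l below, ln 3 / l above.\<close>

lemma ln_card_small_sections_tendsto:
  "(\<lambda>l. ln (real (card (small_sections \<Sigma> \<mu> h l))) / real l ^ (CARD('n) + 1))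
     \<longlonglongrightarrow> (LINT x : \<Theta> | lborel. roof x)" (is "?a \<longlonglongrightarrow> ?I")
proof (rule tendsto_sandwich)
  let ?S = "\<lambda>l. roof_sum l / real l ^ CARD('n)"
  let ?N = "\<lambda>l. real (card (theta_points l)) / real l ^ CARD('n)"
  let ?lo = "\<lambda>l. ?S l - ?N l * (ln (real (card (theta_points l))) / real l)"
  let ?up = "\<lambda>l. ?S l + ?N l * (ln 3 / real l)"
  show "\<forall>\<^sub>F l in sequentially. ?lo l \<le> ?a l"
    using eventually_gt_at_top[of 0]
  proof eventually_elim
    case (elim l)
    have "?lo l = (real l * roof_sum l - real (card (theta_points l)) * ln (real (card (theta_points l))))
        / real l ^ (CARD('n) + 1)"
      using elim by (simp add: field_simps)
    also have "\<dots> \<le> ?a l"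
      by (intro divide_right_mono ln_card_small_sections_ge elim) simp
    finally show ?case .
  qed
  show "\<forall>\<^sub>F l in sequentially. ?a l \<le> ?up l"
    using eventually_gt_at_top[of 0]
  proof eventually_elim
    case (elim l)
    have "?a l \<le> (real l * roof_sum l + real (card (theta_points l)) * ln 3) / real l ^ (CARD('n) + 1)"
      by (intro divide_right_mono ln_card_small_sections_le elim) simp
    also have "\<dots> = ?up l" using elim by (simp add: field_simps)
    finally show ?case .
  qed
  have "?lo \<longlonglongrightarrow> ?I - measure lborel \<Theta> * 0"
    by (intro tendsto_diff tendsto_mult roof_sum_tendsto card_theta_points_tendsto ln_card_theta_points_over_n)
  then show "?lo \<longlonglongrightarrow> ?I" by simp
  have "?up \<longlonglongrightarrow> ?I + measure lborel \<Theta> * 0"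
    by (intro tendsto_add tendsto_mult roof_sum_tendsto card_theta_points_tendsto lim_const_over_n)
  then show "?up \<longlonglongrightarrow> ?I" by simp
qed

lemma arithmetic_volume_eq:
  "arithmetic_volume \<Sigma> \<mu> h = ereal (fact (CARD('n) + 1) * (LINT x : \<Theta> | lborel. roof x))"
proof -
  have "(\<lambda>l. fact (CARD('n) + 1) * (ln (real (card (small_sections \<Sigma> \<mu> h l))) / real l ^ (CARD('n) + 1)))
      \<longlonglongrightarrow> fact (CARD('n) + 1) * (LINT x : \<Theta> | lborel. roof x)"
    by (intro tendsto_mult tendsto_const ln_card_small_sections_tendsto)
  then have "(\<lambda>l. ln (real (card (small_sections \<Sigma> \<mu> h l))) / (real l ^ (CARD('n) + 1) / fact (CARD('n) + 1)))
      \<longlonglongrightarrow> fact (CARD('n) + 1) * (LINT x : \<Theta> | lborel. roof x)"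
    by (simp add: mult.commute)
  then show ?thesis
    unfolding arithmetic_volume_def by (intro lim_imp_Limsup tendsto_ereal) simp_all
qed

end

theorem mainTheorem2:
  fixes \<Sigma> :: "(real ^ 'n::finite) set set"
    and \<psi> :: "real ^ 'n \<Rightarrow> real"
    and \<mu> :: "(real ^ 'n) set \<Rightarrow> int ^ 'n"
    and h :: "(real ^ 'n) set \<Rightarrow> (int ^ 'n \<Rightarrow> complex) \<Rightarrow> real"
  assumes "is_fan \<Sigma>"
    and "smooth_toric \<Sigma>"
    and "projective_toric \<Sigma>"
    and "equivariant_divisor \<Sigma> \<psi> \<mu>"
    and "continuous_hermitian_metric \<Sigma> \<mu> h"
    and "compact_torus_invariant \<Sigma> h"
  shows "arithmetic_volume \<Sigma> \<mu> h =
    ereal (fact (CARD('n) + 1) *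
      (LINT x : theta_set \<psi> (g_metric \<mu> h) | lborel.
         real_of_ereal (legendre_fenchel (g_metric \<mu> h) x)))"
proof -
  interpret metrized_toric_divisor \<Sigma> \<psi> \<mu> h
    using assms projective_toric_complete[OF assms(1,3)] by unfold_locales
  show ?thesis by (rule arithmetic_volume_eq)
qed

end
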